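(* Let $p=p(n)$ satisfy $100/n\le p\le 2\log{n}/n$, and let $G\sim G(n,p)$. Then, with high probability, there exists $U\subseteq [n]$ with $|U|\ge (1-e^{-np/2})n$ such that the induced subgraph $G[U]$ is $d$-rigid for $d=\lfloor np/251\rfloor$.
   Context: A $d$-dimensional framework is a pair $(G,\mathbf{p})$ with $G=(V,E)$ a finite simple graph and $\mathbf{p}:V\to\mathbb{R}^d$. It is rigid if every continuous motion of the vertices starting at $\mathbf{p}$ that preserves all edge lengths preserves the distances between all pairs of vertices. A map $\mathbf{p}$ is generic if its $d|V|$ coordinates are algebraically independent over $\mathbb{Q}$. A graph is $d$-rigid if $(G,\mathbf{p})$ is rigid for some (equivalently, every) generic $\mathbf{p}$. $G(n,p)$ is the random graph on $[n]$ in which each pair is an edge independently with probability $p$. "With high probability" means with probability tending to $1$ as $n\to\infty$. $\log$ is the natural logarithm. *)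

theory Defs
  imports "HOL-Analysis.Analysis" "HOL-Probability.Probability" "HOL-Library.Poly_Mapping"
begin

text \<open>Graphs are given by a vertex set and a set of edges, an edge being a two-element set.\<close>

definition simple_graph :: "'v set \<Rightarrow> 'v set set \<Rightarrow> bool" where
  "simple_graph V E \<longleftrightarrow> finite V \<and> (\<forall>e\<in>E. e \<subseteq> V \<and> card e = 2)"

definition induced_edges :: "'v set set \<Rightarrow> 'v set \<Rightarrow> 'v set set" where
  "induced_edges E U = {e \<in> E. e \<subseteq> U}"

text \<open>
  The dimension varies with the number of vertices, so points of d-dimensional space are elements
  of \<^const>\<open>Euclidean_space\<close> \<open>d\<close>, i.e. functions on the naturals that vanish from index \<open>d\<close> on.
\<close>

definition edist :: "nat \<Rightarrow> (nat \<Rightarrow> real) \<Rightarrow> (nat \<Rightarrow> real) \<Rightarrow> real" where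
  "edist d x y = L2_set (\<lambda>i. x i - y i) {..<d}"

definition framework :: "nat \<Rightarrow> 'v set \<Rightarrow> 'v set set \<Rightarrow> ('v \<Rightarrow> nat \<Rightarrow> real) \<Rightarrow> bool" where
  "framework d V E pos \<longleftrightarrow>
     simple_graph V E \<and> (\<forall>v\<in>V. pos v \<in> topspace (Euclidean_space d))"

definition continuous_motion ::
  "nat \<Rightarrow> 'v set \<Rightarrow> ('v \<Rightarrow> nat \<Rightarrow> real) \<Rightarrow> (real \<Rightarrow> 'v \<Rightarrow> nat \<Rightarrow> real) \<Rightarrow> bool" where
  "continuous_motion d V pos q \<longleftrightarrow>
     (\<forall>v\<in>V. continuous_map (top_of_set {0..1}) (Euclidean_space d) (\<lambda>t. q t v) \<and> q 0 v = pos v)"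

definition rigid :: "nat \<Rightarrow> 'v set \<Rightarrow> 'v set set \<Rightarrow> ('v \<Rightarrow> nat \<Rightarrow> real) \<Rightarrow> bool" where
  "rigid d V E pos \<longleftrightarrow>
     (\<forall>q. continuous_motion d V pos q \<longrightarrow>
        (\<forall>t\<in>{0..1}. \<forall>u\<in>V. \<forall>v\<in>V. {u, v} \<in> E \<longrightarrow> edist d (q t u) (q t v) = edist d (pos u) (pos v)) \<longrightarrow>
        (\<forall>t\<in>{0..1}. \<forall>u\<in>V. \<forall>v\<in>V. edist d (q t u) (q t v) = edist d (pos u) (pos v)))"

text \<open>
  A polynomial with rational coefficients in variables indexed by \<open>'i\<close> is a finitely supported map
  from monomials to \<open>rat\<close>, a monomial being a finitely supported map from variables to exponents.
\<close>

definition poly_value :: "('i \<Rightarrow> real) \<Rightarrow> (('i \<Rightarrow>\<^sub>0 nat) \<Rightarrow>\<^sub>0 rat) \<Rightarrow> real" where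
  "poly_value x P =
     (\<Sum>m\<in>Poly_Mapping.keys P. of_rat (Poly_Mapping.lookup P m) *
        (\<Prod>i\<in>Poly_Mapping.keys m. x i ^ Poly_Mapping.lookup m i))"

definition algebraically_independent :: "'i set \<Rightarrow> ('i \<Rightarrow> real) \<Rightarrow> bool" where
  "algebraically_independent I x \<longleftrightarrow>
     (\<forall>P. (\<forall>m\<in>Poly_Mapping.keys P. Poly_Mapping.keys m \<subseteq> I) \<longrightarrow> poly_value x P = 0 \<longrightarrow> P = 0)"

definition generic :: "nat \<Rightarrow> 'v set \<Rightarrow> ('v \<Rightarrow> nat \<Rightarrow> real) \<Rightarrow> bool" where
  "generic d V pos \<longleftrightarrow> algebraically_independent (V \<times> {..<d}) (\<lambda>(v, i). pos v i)"

definition d_rigid :: "nat \<Rightarrow> 'v set \<Rightarrow> 'v set set \<Rightarrow> bool" where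
  "d_rigid d V E \<longleftrightarrow> (\<exists>pos. framework d V E pos \<and> generic d V pos \<and> rigid d V E pos)"

definition vertex_pairs :: "nat \<Rightarrow> nat set set" where
  "vertex_pairs n = {e. e \<subseteq> {1..n} \<and> card e = 2}"

text \<open>The distribution of the edge set of the random graph on \<open>{1..n}\<close>; meant for \<open>0 \<le> p \<le> 1\<close>.\<close>

definition random_graph :: "nat \<Rightarrow> real \<Rightarrow> nat set set pmf" where
  "random_graph n p =
     map_pmf (\<lambda>f. {e \<in> vertex_pairs n. f e})
       (Pi_pmf (vertex_pairs n) False (\<lambda>_. bernoulli_pmf p))"

end

theory Submission
  imports Defs "Jordan_Normal_Form.Determinant" "HOL-Real_Asymp.Real_Asymp"
begin

text \<open>
  Fix one placement \<open>x\<close> of the vertices that is generic for the rigidity matroid, and consider for a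
  vertex set \<open>U\<close> the pairs in \<open>U\<close> whose row lies in the span of the rows of \<open>G[U]\<close>. If these missed
  more than \<open>0.04 n^2\<close> pairs, then so would the span of a basis \<open>B \<subseteq> G[U]\<close>, which has at most \<open>d n\<close>
  elements; a union bound over all \<open>U\<close> and \<open>B\<close> rules this out when \<open>n p \<ge> 251 d\<close>. So the span always
  contains a dense graph, and a random labelling of a dense graph with \<open>d + 1\<close> colours shows that it
  contains all rows of a full-rank graph on a set \<open>W\<close> of linear size: place the colour classes at
  the vertices of a simplex.

  A vertex of \<open>U\<close> with \<open>d\<close> neighbours in \<open>W\<close> can be added to \<open>W\<close>. Since no set of between
  \<open>exp (-n p / 2) n\<close> and \<open>0.3 n\<close> vertices has all its vertices sending fewer than \<open>d\<close> edges outside,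
  choosing \<open>U\<close> minimal among the large sets into which every outside vertex sends fewer than \<open>d\<close>
  edges forces \<open>W = U\<close>, so that \<open>G[U]\<close> itself has full rank.
\<close>

subsection \<open>Linear independence of finite families\<close>

text \<open>The graph is too sparse for the labelling argument: its vertices have about n p <= 2 ln
  n neighbours, so two of them rarely share one. Only the flat spanned by its rows is dense. The
  labelling is applied to the flat, and the rank found there is a rank of \<open>G[U]\<close>,
  because the flat does not enlarge the span.

  The flat depends on the random graph and on \<open>U\<close>, and \<open>U\<close> is chosen after
  the graph is seen. Hence density is established for all \<open>U\<close> at once, and a basis
  replaces the edge set: it determines the flat and has few enough elements for a union bound.

  Two kinds of genericity occur. Rank arguments use a placement that is maximal for independent
  rows, whereas \<open>d_rigid\<close> asks for algebraically independent coordinates. Perturbation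
  links them: rows that are independent at one point of a line are independent at all but finitely
  many of its points.\<close>

unbundle no vec_syntax

text \<open>Independence is that of an indexed family: in a finite family, two pairs with equal rows
  count as dependent, so cardinalities of index sets are ranks.\<close>

definition indep_family :: "('e \<Rightarrow> 'k \<Rightarrow> real) \<Rightarrow> 'e set \<Rightarrow> bool" where
  "indep_family v B \<longleftrightarrow> (\<forall>c. (\<forall>k. (\<Sum>e\<in>B. c e * v e k) = 0) \<longrightarrow> (\<forall>e\<in>B. c e = 0))"

definition family_span :: "('e \<Rightarrow> 'k \<Rightarrow> real) \<Rightarrow> 'e set \<Rightarrow> ('k \<Rightarrow> real) set" where
  "family_span v B = {r. \<exists>c. \<forall>k. r k = (\<Sum>e\<in>B. c e * v e k)}"

lemma indep_familyD:
  "indep_family v B \<Longrightarrow> (\<And>k. (\<Sum>e\<in>B. c e * v e k) = 0) \<Longrightarrow> e \<in> B \<Longrightarrow> c e = 0"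
  unfolding indep_family_def by blast

lemma indep_family_cong:
  assumes "\<And>e k. e \<in> B \<Longrightarrow> v e k = w e k"
  shows "indep_family v B \<longleftrightarrow> indep_family w B"
  unfolding indep_family_def using assms by (auto cong: sum.cong)

lemma family_span_base:
  assumes "finite B" "e \<in> B"
  shows "v e \<in> family_span v B"
proof -
  have "(\<Sum>f\<in>B. (if f = e then 1 else 0) * v f k) = v e k" for k
    using assms by (simp add: if_distrib[of "\<lambda>a. a * _"] sum.delta cong: if_cong)
  then show ?thesis
    unfolding family_span_def mem_Collect_eq by (intro exI[of _ "\<lambda>f. if f = e then 1 else 0"]) simp
qed

lemma family_span_lincomb:
  assumes "r \<in> family_span v B" "s \<in> family_span v B" "\<And>k. q k = a * r k + b * s k"
  shows "q \<in> family_span v B"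
proof -
  obtain c d where c: "\<forall>k. r k = (\<Sum>e\<in>B. c e * v e k)" and d: "\<forall>k. s k = (\<Sum>e\<in>B. d e * v e k)"
    using assms unfolding family_span_def by blast
  have "\<forall>k. q k = (\<Sum>e\<in>B. (a * c e + b * d e) * v e k)"
    by (simp add: assms(3) c d sum_distrib_left sum.distrib algebra_simps)
  then show ?thesis
    unfolding family_span_def mem_Collect_eq by (intro exI[of _ "\<lambda>e. a * c e + b * d e"])
qed

lemma family_span_sum:
  assumes "finite A" "\<And>a. a \<in> A \<Longrightarrow> u a \<in> family_span v B"
    "\<And>k. q k = (\<Sum>a\<in>A. c a * u a k)"
  shows "q \<in> family_span v B"
  using assms
proof (induction A arbitrary: q rule: finite_induct)
  case empty
  then show ?case
    unfolding family_span_def by (auto intro!: exI[of _ "\<lambda>_. 0"])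
next
  case (insert a A)
  have "(\<lambda>k. \<Sum>a\<in>A. c a * u a k) \<in> family_span v B"
    by (rule insert.IH) (use insert.prems in auto)
  then show ?case
    using insert.hyps insert.prems
    by (intro family_span_lincomb[of "u a" v B _ q "c a" 1]) auto
qed

lemma family_span_trans:
  assumes "finite A" "\<And>a. a \<in> A \<Longrightarrow> u a \<in> family_span v B" "r \<in> family_span u A"
  shows "r \<in> family_span v B"
proof -
  obtain c where "\<forall>k. r k = (\<Sum>e\<in>A. c e * u e k)"
    using assms(3) unfolding family_span_def by blast
  then show ?thesis by (intro family_span_sum[OF assms(1,2)]) auto
qed

text \<open>Gaussian elimination: an equation with a nonzero coefficient is solved for one unknown
  \<open>b\<close>, and the remaining equations continue without it.\<close>

lemma homogeneous_system:
  fixes M :: "'a \<Rightarrow> 'k \<Rightarrow> real"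
  assumes "finite D" "finite A" "card D < card A"
  shows "\<exists>c. (\<exists>a\<in>A. c a \<noteq> 0) \<and> (\<forall>k\<in>D. (\<Sum>a\<in>A. c a * M a k) = 0)"
  using assms
proof (induction D arbitrary: A M rule: finite_induct)
  case empty
  then obtain a where "a \<in> A" by fastforce
  then show ?case by (intro exI[of _ "\<lambda>_. 1"]) auto
next
  case (insert k D)
  show ?case
  proof (cases "\<forall>a\<in>A. M a k = 0")
    case True
    have "card D < card A" using insert by simp
    from insert.IH[OF insert.prems(1) this, of M] obtain c
      where "\<exists>a\<in>A. c a \<noteq> 0" "\<forall>k\<in>D. (\<Sum>a\<in>A. c a * M a k) = 0" by blast
    then show ?thesis using True by (intro exI[of _ c]) auto
  next
    case False
    then obtain b where b: "b \<in> A" "M b k \<noteq> 0" by blast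
    define N where "N = (\<lambda>a j. M a j - M a k / M b k * M b j)"
    have "card D < card (A - {b})" using insert b by simp
    from insert.IH[OF _ this, of N] insert.prems obtain c
      where c: "\<exists>a\<in>A - {b}. c a \<noteq> 0" "\<forall>k\<in>D. (\<Sum>a\<in>A - {b}. c a * N a k) = 0" by auto
    \<comment> \<open>\<open>s\<close> is the value of the unknown \<open>b\<close> that makes
      equation \<open>k\<close> hold.\<close>
    define s where "s = - (\<Sum>a\<in>A - {b}. c a * (M a k / M b k))"
    define c' where "c' = c(b := s)"
    have sum: "(\<Sum>a\<in>A. c' a * M a j) = (\<Sum>a\<in>A - {b}. c a * N a j)" for j
    proof -
      have "(\<Sum>a\<in>A. c' a * M a j) = s * M b j + (\<Sum>a\<in>A - {b}. c a * M a j)"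
        using insert.prems b by (subst sum.remove[of _ b]) (auto simp: c'_def)
      also have "\<dots> = (\<Sum>a\<in>A - {b}. c a * N a j)"
        unfolding s_def N_def right_diff_distrib sum_subtractf by (simp add: sum_distrib_left algebra_simps)
      finally show ?thesis .
    qed
    have "(\<Sum>a\<in>A - {b}. c a * N a k) = 0"
      using b by (simp add: N_def)
    then show ?thesis
      using c sum by (intro exI[of _ c']) (auto simp: c'_def)
  qed
qed

text \<open>Steinitz bound: if \<open>A\<close> were larger, the coefficients of the
  \<open>u a\<close> over \<open>v\<close> would admit a nonzero solution of \<open>card B\<close>
  homogeneous equations, which is a relation among the \<open>u a\<close>.\<close>

lemma card_indep_family_le:
  assumes "finite A" "finite B" "indep_family u A" "\<And>a. a \<in> A \<Longrightarrow> u a \<in> family_span v B"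
  shows "card A \<le> card B"
proof (rule ccontr)
  assume "\<not> card A \<le> card B"
  have "\<forall>a\<in>A. \<exists>c. \<forall>k. u a k = (\<Sum>e\<in>B. c e * v e k)"
    using assms(4) unfolding family_span_def by blast
  then obtain M where M: "\<And>a k. a \<in> A \<Longrightarrow> u a k = (\<Sum>e\<in>B. M a e * v e k)"
    by metis
  obtain c where c: "\<exists>a\<in>A. c a \<noteq> 0" "\<forall>e\<in>B. (\<Sum>a\<in>A. c a * M a e) = 0"
    using homogeneous_system[of B A M] assms \<open>\<not> card A \<le> card B\<close> by auto
  have "(\<Sum>a\<in>A. c a * u a k) = 0" for k
  proof -
    have "(\<Sum>a\<in>A. c a * u a k) = (\<Sum>a\<in>A. \<Sum>e\<in>B. c a * M a e * v e k)"
      by (intro sum.cong refl) (simp add: M sum_distrib_left algebra_simps)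
    also have "\<dots> = (\<Sum>e\<in>B. (\<Sum>a\<in>A. c a * M a e) * v e k)"
      by (subst sum.swap) (simp add: sum_distrib_right)
    finally show ?thesis using c(2) by simp
  qed
  then show False using c(1) indep_familyD[OF assms(3), of c] by blast
qed

lemma family_span_if_dependent_insert:
  assumes "finite B" "indep_family v B" "\<not> indep_family v (insert e B)"
  shows "v e \<in> family_span v B"
proof (cases "e \<in> B")
  case True
  then show ?thesis using assms by (simp add: insert_absorb)
next
  case False
  obtain c a where c: "\<forall>k. (\<Sum>f\<in>insert e B. c f * v f k) = 0" and a: "a \<in> insert e B" "c a \<noteq> 0"
    using assms(3) unfolding indep_family_def by blast
  have sum: "c e * v e k + (\<Sum>f\<in>B. c f * v f k) = 0" for k
    using c[rule_format, of k] False assms(1) by simp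
  have ce: "c e \<noteq> 0"
  proof
    assume "c e = 0"
    then have "\<And>k. (\<Sum>f\<in>B. c f * v f k) = 0" using sum by simp
    from indep_familyD[OF assms(2) this] \<open>c e = 0\<close> a show False by auto
  qed
  have "v e k = (\<Sum>f\<in>B. (- c f / c e) * v f k)" for k
  proof -
    have "v e k = - (\<Sum>f\<in>B. c f * v f k) / c e"
      using sum[of k] ce by (simp add: field_simps)
    then show ?thesis by (simp add: sum_divide_distrib sum_negf)
  qed
  then show ?thesis
    unfolding family_span_def mem_Collect_eq by (intro exI[of _ "\<lambda>f. - c f / c e"]) blast
qed

lemma family_basis_exists:
  assumes "finite H"
  obtains B where "B \<subseteq> H" "indep_family v B" "\<And>e. e \<in> H \<Longrightarrow> v e \<in> family_span v B"
proof -
  let ?S = "{B. B \<subseteq> H \<and> indep_family v B}"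
  have "?S \<subseteq> Pow H" by blast
  then have "finite ?S" using assms finite_subset by blast
  moreover have "{} \<in> ?S" by (simp add: indep_family_def)
  ultimately have "\<exists>B\<in>?S. \<forall>C\<in>?S. B \<subseteq> C \<longrightarrow> B = C"
    by (intro finite_has_maximal) auto
  then obtain B where B: "B \<in> ?S" "\<And>C. C \<in> ?S \<Longrightarrow> B \<subseteq> C \<Longrightarrow> B = C"
    by (elim bexE) simp
  have fin: "finite B" using B(1) assms by (auto intro: finite_subset)
  have "v e \<in> family_span v B" if "e \<in> H" for e
  proof (cases "e \<in> B")
    case True
    then show ?thesis using fin by (rule family_span_base[rotated])
  next
    case False
    then have "B \<noteq> insert e B" by blast
    then have "insert e B \<notin> ?S" using B(2)[of "insert e B"] by blast
    then have "\<not> indep_family v (insert e B)" using B(1) that by simp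
    moreover have "indep_family v B" using B(1) by simp
    ultimately show ?thesis by (intro family_span_if_dependent_insert[OF fin])
  qed
  moreover have "B \<subseteq> H" "indep_family v B" using B(1) by simp_all
  ultimately show ?thesis by (rule that[rotated 2])
qed

text \<open>A relation gives a vector \<open>r = -s\<close> in both spans. It is orthogonal to
  itself on \<open>D\<close> and vanishes outside \<open>D\<close> because \<open>v\<close> does, so
  both partial sums are zero.\<close>

lemma indep_family_Un_Plus:
  fixes v :: "'e \<Rightarrow> 'k \<Rightarrow> real" and u :: "'f \<Rightarrow> 'k \<Rightarrow> real"
  assumes fin: "finite D" "finite B" "finite C" 
    and supp: "\<And>e k. e \<in> B \<Longrightarrow> k \<notin> D \<Longrightarrow> v e k = 0"
    and indep: "indep_family v B" "indep_family u C"
    and orth: "\<And>e f. e \<in> B \<Longrightarrow> f \<in> C \<Longrightarrow> (\<Sum>k\<in>D. v e k * u f k) = 0"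
  shows "indep_family (case_sum v u) (B <+> C)"
  unfolding indep_family_def
proof (intro allI impI)
  fix c :: "'e + 'f \<Rightarrow> real"
  assume "\<forall>k. (\<Sum>e\<in>B <+> C. c e * case_sum v u e k) = 0"
  then have c: "(\<Sum>e\<in>B. c (Inl e) * v e k) + (\<Sum>f\<in>C. c (Inr f) * u f k) = 0" for k
    using fin by (simp add: sum.Plus)
  define r where "r = (\<lambda>k. \<Sum>e\<in>B. c (Inl e) * v e k)"
  define s where "s = (\<lambda>k. \<Sum>f\<in>C. c (Inr f) * u f k)"
  have rs: "r k = - s k" for k using c[of k] by (simp add: r_def s_def)
  have "(\<Sum>k\<in>D. r k * s k) = (\<Sum>k\<in>D. \<Sum>e\<in>B. \<Sum>f\<in>C. (c (Inl e) * c (Inr f)) * (v e k * u f k))"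
    by (simp add: r_def s_def sum_product mult.commute mult.left_commute)
  also have "\<dots> = (\<Sum>e\<in>B. \<Sum>f\<in>C. (c (Inl e) * c (Inr f)) * (\<Sum>k\<in>D. v e k * u f k))"
    by (subst sum.swap, rule sum.cong[OF refl], subst sum.swap) (simp add: sum_distrib_left)
  also have "\<dots> = 0" using orth by simp
  finally have "(\<Sum>k\<in>D. r k * s k) = 0" .
  moreover have "r k * r k = - (r k * s k)" for k by (subst (2) rs) simp
  ultimately have "(\<Sum>k\<in>D. r k * r k) = 0" by (simp only: sum_negf)
  then have "r k = 0" if "k \<in> D" for k
    using that fin by (subst (asm) sum_nonneg_eq_0_iff) auto
  moreover have "r k = 0" if "k \<notin> D" for k using supp that by (simp add: r_def)
  ultimately have r0: "r k = 0" for k by blast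
  then have s0: "s k = 0" for k using rs[of k] by simp
  have "c (Inl e) = 0" if "e \<in> B" for e
    using indep_familyD[OF indep(1), of "\<lambda>e. c (Inl e)"] r0 that unfolding r_def by blast
  moreover have "c (Inr f) = 0" if "f \<in> C" for f
    using indep_familyD[OF indep(2), of "\<lambda>e. c (Inr e)"] s0 that unfolding s_def by blast
  ultimately show "\<forall>e\<in>B <+> C. c e = 0" by auto
qed

lemma card_indep_family_le_support:
  assumes "finite D" "finite B" "indep_family v B" "\<And>e k. e \<in> B \<Longrightarrow> k \<notin> D \<Longrightarrow> v e k = 0"
  shows "card B \<le> card D"
proof (rule card_indep_family_le[OF assms(2,1,3)])
  fix e assume "e \<in> B"
  have "v e k = (\<Sum>j\<in>D. v e j * (if k = j then 1 else 0))" for k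
    using assms \<open>e \<in> B\<close> by (auto simp: if_distrib[of "\<lambda>a. _ * a"] sum.delta cong: if_cong)
  then show "v e \<in> family_span (\<lambda>j k. if k = j then 1 else 0) D"
    unfolding family_span_def by blast
qed

lemma indep_family_unit: "indep_family (\<lambda>j k. if k = j then 1 else 0) D" if "finite D"
  unfolding indep_family_def
proof (intro allI impI ballI)
  fix c :: "'a \<Rightarrow> real" and j assume c: "\<forall>k. (\<Sum>j\<in>D. c j * (if k = j then 1 else 0)) = 0" and "j \<in> D"
  have "(\<Sum>i\<in>D. c i * (if j = i then 1 else 0)) = c j"
    using that \<open>j \<in> D\<close> by (simp add: if_distrib[of "\<lambda>a. _ * a"] sum.delta cong: if_cong)
  then show "c j = 0" using c by metis
qed

section \<open>Gram determinants as certificates of independence\<close>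

text \<open>The determinant of the matrix of inner products of two families, a polynomial in the second
  one, certifies independence of the second family and does not vanish when both coincide.\<close>

definition gram_matrix ::
  "'k set \<Rightarrow> (nat \<Rightarrow> 'e) \<Rightarrow> nat \<Rightarrow> ('e \<Rightarrow> 'k \<Rightarrow> real) \<Rightarrow> ('e \<Rightarrow> 'k \<Rightarrow> real) \<Rightarrow> real mat" where
  "gram_matrix D g n v w = mat n n (\<lambda>(i, j). \<Sum>k\<in>D. v (g i) k * w (g j) k)"

lemma gram_matrix_mult_vec:
  assumes "x \<in> carrier_vec n" "i < n"
  shows "(gram_matrix D g n v w *\<^sub>v x) $ i = (\<Sum>k\<in>D. v (g i) k * (\<Sum>j<n. x $ j * w (g j) k))"
proof -
  have "(gram_matrix D g n v w *\<^sub>v x) $ i = (\<Sum>j<n. (\<Sum>k\<in>D. v (g i) k * w (g j) k) * x $ j)"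
    using assms by (simp add: gram_matrix_def scalar_prod_def atLeast0LessThan)
  also have "\<dots> = (\<Sum>k\<in>D. \<Sum>j<n. v (g i) k * w (g j) k * x $ j)"
    by (simp add: sum_distrib_right) (rule sum.swap)
  finally show ?thesis by (simp add: sum_distrib_left mult.assoc mult.commute mult.left_commute)
qed

text \<open>A kernel vector gives a combination \<open>r\<close> that is orthogonal to each member
  of the family, hence to itself, so \<open>r = 0\<close> against independence.\<close>

lemma det_gram_matrix_self:
  assumes "finite D" "bij_betw g {..<n} B" "indep_family v B"
    "\<And>e k. e \<in> B \<Longrightarrow> k \<notin> D \<Longrightarrow> v e k = 0"
  shows "det (gram_matrix D g n v v) \<noteq> 0"
proof
  assume "det (gram_matrix D g n v v) = 0"
  moreover have "gram_matrix D g n v v \<in> carrier_mat n n" by (simp add: gram_matrix_def)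
  ultimately obtain x where x: "x \<in> carrier_vec n" "x \<noteq> 0\<^sub>v n" "gram_matrix D g n v v *\<^sub>v x = 0\<^sub>v n"
    using det_0_iff_vec_prod_zero_field by blast
  define h where "h = the_inv_into {..<n} g"
  have h: "h (g j) = j" if "j < n" for j
    using assms(2) that by (auto simp: h_def bij_betw_def the_inv_into_f_f)
  define r where "r = (\<lambda>k. \<Sum>j<n. x $ j * v (g j) k)"
  have r: "r k = (\<Sum>e\<in>B. x $ (h e) * v e k)" for k
    unfolding r_def using h by (subst sum.reindex_bij_betw[OF assms(2), symmetric]) simp
  have z: "(\<Sum>k\<in>D. v (g i) k * r k) = 0" if "i < n" for i
    using gram_matrix_mult_vec[OF x(1) that, of D g v v] x(3) that unfolding r_def by simp
  have "(\<Sum>k\<in>D. r k * r k) = (\<Sum>k\<in>D. \<Sum>i<n. x $ i * (v (g i) k * r k))"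
    by (subst (1) r_def) (simp add: sum_distrib_right mult.assoc)
  also have "\<dots> = (\<Sum>i<n. x $ i * (\<Sum>k\<in>D. v (g i) k * r k))"
    by (subst sum.swap) (simp add: sum_distrib_left)
  also have "\<dots> = 0" using z by simp
  finally have "r k = 0" if "k \<in> D" for k
    using that assms(1) by (subst (asm) sum_nonneg_eq_0_iff) auto
  moreover have "r k = 0" if "k \<notin> D" for k using assms(4) that by (simp add: r)
  ultimately have "\<And>k. (\<Sum>e\<in>B. x $ (h e) * v e k) = 0" using r by metis
  from indep_familyD[OF assms(3) this] have "\<forall>e\<in>B. x $ (h e) = 0" by blast
  then have "x $ j = 0" if "j < n" for j
    using h[OF that] that assms(2) by (force simp: bij_betw_def)
  then have "x = 0\<^sub>v n" using x(1) by auto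
  with x(2) show False by contradiction
qed

lemma indep_family_if_det_gram_matrix:
  assumes "bij_betw g {..<n} B" "det (gram_matrix D g n v w) \<noteq> 0"
  shows "indep_family w B"
  unfolding indep_family_def
proof (intro allI impI ballI)
  fix c e assume c: "\<forall>k. (\<Sum>e\<in>B. c e * w e k) = 0" and e: "e \<in> B"
  define x where "x = vec n (\<lambda>j. c (g j))"
  have "(\<Sum>j<n. x $ j * w (g j) k) = (\<Sum>e\<in>B. c e * w e k)" for k
    by (subst sum.reindex_bij_betw[OF assms(1), symmetric]) (simp add: x_def)
  then have 0: "(\<Sum>j<n. x $ j * w (g j) k) = 0" for k using c by simp
  have "gram_matrix D g n v w *\<^sub>v x = 0\<^sub>v n"
  proof (rule eq_vecI)
    show "dim_vec (gram_matrix D g n v w *\<^sub>v x) = dim_vec (0\<^sub>v n)" by (simp add: gram_matrix_def)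
    show "(gram_matrix D g n v w *\<^sub>v x) $ i = 0\<^sub>v n $ i" if "i < dim_vec (0\<^sub>v n)" for i
      using that gram_matrix_mult_vec[of x n i D g v w] by (simp add: 0) (simp add: x_def)
  qed
  moreover have "gram_matrix D g n v w \<in> carrier_mat n n" by (simp add: gram_matrix_def)
  moreover have "x \<in> carrier_vec n" by (simp add: x_def)
  ultimately have "x = 0\<^sub>v n" using assms(2) det_0_iff_vec_prod_zero_field by blast
  moreover obtain j where "j < n" "e = g j" using e assms(1) by (auto simp: bij_betw_def)
  ultimately show "c e = 0" by (metis x_def index_vec index_zero_vec(1))
qed

lemma det_gram_matrix_eq:
  "det (gram_matrix D g n v w) = (\<Sum>p \<in> {p. p permutes {0..<n}}. signof p * 
     (\<Prod>i = 0..<n. \<Sum>k\<in>D. v (g i) k * w (g (p i)) k))"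
proof -
  have "det (gram_matrix D g n v w) = (\<Sum>p \<in> {p. p permutes {0..<n}}. signof p * 
     (\<Prod>i = 0..<n. gram_matrix D g n v w $$ (i, p i)))"
    by (rule det_def') (simp add: gram_matrix_def)
  also have "\<dots> = (\<Sum>p \<in> {p. p permutes {0..<n}}. signof p * 
     (\<Prod>i = 0..<n. \<Sum>k\<in>D. v (g i) k * w (g (p i)) k))"
  proof (intro sum.cong prod.cong refl arg_cong2[of _ _ _ _ "(*)"])
    fix p i assume "p \<in> {p. p permutes {0..<n}}" "i \<in> {0..<n}"
    then have "i < n" "p i < n" using permutes_in_image[of p "{0..<n}" i] by auto
    then show "gram_matrix D g n v w $$ (i, p i) = (\<Sum>k\<in>D. v (g i) k * w (g (p i)) k)"
      by (simp add: gram_matrix_def)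
  qed
  finally show ?thesis .
qed

text \<open>With the first argument frozen at \<open>v s\<close>, the Gram determinant is a
  polynomial in \<open>t\<close> that is nonzero at \<open>t = s\<close>, and every dependent
  \<open>t\<close> is one of its finitely many roots.\<close>

lemma finite_dependent_pencil:
  fixes v :: "real \<Rightarrow> 'e \<Rightarrow> 'k \<Rightarrow> real"
  assumes "finite D" "finite B" "indep_family (v s) B"
    and supp: "\<And>e k. e \<in> B \<Longrightarrow> k \<notin> D \<Longrightarrow> v s e k = 0"
    and pencil: "\<And>t e k. e \<in> B \<Longrightarrow> v t e k = a e k + t * b e k"
  shows "finite {t. \<not> indep_family (v t) B}"
proof -
  obtain g where g: "bij_betw g {..<card B} B"
    using ex_bij_betw_nat_finite[OF assms(2)] by (auto simp: atLeast0LessThan)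
  define n where "n = card B"
  have g: "bij_betw g {..<n} B" using g by (simp add: n_def)
  define P where "P = (\<Sum>p \<in> {p. p permutes {0..<n}}. [:signof p:] * 
     (\<Prod>i = 0..<n. \<Sum>k\<in>D. [:v s (g i) k * a (g (p i)) k, v s (g i) k * b (g (p i)) k:]))"
  have P: "poly P t = det (gram_matrix D g n (v s) (v t))" for t
    unfolding P_def det_gram_matrix_eq poly_sum poly_mult poly_prod
  proof (intro sum.cong prod.cong refl arg_cong2[of _ _ _ _ "(*)"])
    fix p i k assume "p \<in> {p. p permutes {0..<n}}" "i \<in> {0..<n}"
    then have "p i < n" using permutes_in_image[of p "{0..<n}" i] by auto
    then have "g (p i) \<in> B" using g by (auto simp: bij_betw_def)
    then show "poly [:v s (g i) k * a (g (p i)) k, v s (g i) k * b (g (p i)) k:] t =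
      v s (g i) k * v t (g (p i)) k"
      by (subst pencil) (auto simp: algebra_simps)
  qed auto
  have "poly P s \<noteq> 0"
    unfolding P using det_gram_matrix_self[OF assms(1) g assms(3) supp] .
  then have "P \<noteq> 0" by auto
  then have "finite {t. poly P t = 0}" by (rule poly_roots_finite)
  moreover have "{t. \<not> indep_family (v t) B} \<subseteq> {t. poly P t = 0}"
    using indep_family_if_det_gram_matrix[OF g] unfolding P by blast
  ultimately show ?thesis by (rule finite_subset[rotated])
qed

text \<open>The determinant with its first argument frozen at \<open>v\<close> is continuous in the
  second family and nonzero at the limit.\<close>

lemma eventually_indep_family:
  assumes "finite D" "finite B" "indep_family v B"
    and supp: "\<And>e k. e \<in> B \<Longrightarrow> k \<notin> D \<Longrightarrow> v e k = 0"
    and lim: "\<And>e k. e \<in> B \<Longrightarrow> k \<in> D \<Longrightarrow> ((\<lambda>t. w t e k) \<longlongrightarrow> v e k) F"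
  shows "\<forall>\<^sub>F t in F. indep_family (w t) B"
proof -
  obtain g where g: "bij_betw g {..<card B} B"
    using ex_bij_betw_nat_finite[OF assms(2)] by (auto simp: atLeast0LessThan)
  define n where "n = card B"
  have g: "bij_betw g {..<n} B" using g by (simp add: n_def)
  have "((\<lambda>t. det (gram_matrix D g n v (w t))) \<longlongrightarrow> det (gram_matrix D g n v v)) F"
    unfolding det_gram_matrix_eq
  proof (intro tendsto_sum tendsto_mult tendsto_prod tendsto_const)
    fix p i k assume "p \<in> {p. p permutes {0..<n}}" "i \<in> {0..<n}" "k \<in> D"
    then have "p i < n" using permutes_in_image[of p "{0..<n}" i] by auto
    then have "g (p i) \<in> B" using g by (auto simp: bij_betw_def)
    then show "((\<lambda>t. w t (g (p i)) k) \<longlongrightarrow> v (g (p i)) k) F" using lim \<open>k \<in> D\<close> by blast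
  qed
  then have "\<forall>\<^sub>F t in F. det (gram_matrix D g n v (w t)) \<noteq> 0"
    using det_gram_matrix_self[OF assms(1) g assms(3) supp] by (rule tendsto_imp_eventually_ne)
  then show ?thesis
    by (rule eventually_mono) (rule indep_family_if_det_gram_matrix[OF g])
qed

subsection \<open>Rows of the rigidity matrix\<close>

definition all_pairs :: "'v set \<Rightarrow> 'v set set" where
  "all_pairs W = {e. e \<subseteq> W \<and> card e = 2}"

text \<open>For \<open>e = {u, v}\<close> the entry of the row at \<open>u\<close> is \<open>(x u - x u) + (x u - x v)\<close>.\<close>

definition rigidity_row :: "nat \<Rightarrow> ('v \<Rightarrow> nat \<Rightarrow> real) \<Rightarrow> 'v set \<Rightarrow> 'v \<times> nat \<Rightarrow> real" where
  "rigidity_row d x e = (\<lambda>(w, i). if w \<in> e \<and> i < d then \<Sum>z\<in>e. x w i - x z i else 0)"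

lemma finite_all_pairs: "finite W \<Longrightarrow> finite (all_pairs W)"
  unfolding all_pairs_def by simp

lemma all_pairs_mono: "U \<subseteq> W \<Longrightarrow> all_pairs U \<subseteq> all_pairs W"
  unfolding all_pairs_def by auto

lemma in_all_pairsE:
  assumes "e \<in> all_pairs W"
  obtains u v where "e = {u, v}" "u \<noteq> v" "u \<in> W" "v \<in> W"
  using assms unfolding all_pairs_def by (auto simp: card_2_iff)

lemma pair_in_all_pairs: "{u, v} \<in> all_pairs W \<longleftrightarrow> u \<noteq> v \<and> u \<in> W \<and> v \<in> W"
  unfolding all_pairs_def by (auto simp: card_2_iff')

lemma rigidity_row_outside:
  "e \<in> all_pairs W \<Longrightarrow> k \<notin> W \<times> {..<d} \<Longrightarrow> rigidity_row d x e k = 0"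
  unfolding rigidity_row_def all_pairs_def by (auto split: prod.splits)

lemma rigidity_row_linear:
  "rigidity_row d (\<lambda>v i. a v i + t * b v i) e k = rigidity_row d a e k + t * rigidity_row d b e k"
  unfolding rigidity_row_def
  by (auto split: prod.splits simp: sum_distrib_left sum.distrib[symmetric] algebra_simps intro!: sum.cong)

lemma rigidity_row_cong:
  "(\<And>v i. v \<in> e \<Longrightarrow> i < d \<Longrightarrow> x v i = y v i) \<Longrightarrow> rigidity_row d x e k = rigidity_row d y e k"
  unfolding rigidity_row_def by (auto split: prod.splits intro!: sum.cong)

lemma rigidity_row_pair:
  "u \<noteq> v \<Longrightarrow> rigidity_row d x {u, v} (w, i) =
     (if i < d then (if w = u then x u i - x v i else if w = v then x v i - x u i else 0) else 0)"
  unfolding rigidity_row_def by auto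

lemma sum_rigidity_row_mult:
  assumes "finite W" "u \<in> W" "v \<in> W" "u \<noteq> v"
  shows "(\<Sum>k\<in>W \<times> {..<d}. rigidity_row d x {u, v} k * a k) =
     (\<Sum>i<d. (x u i - x v i) * (a (u, i) - a (v, i)))"
proof -
  have "(\<Sum>k\<in>W \<times> {..<d}. rigidity_row d x {u, v} k * a k) =
      (\<Sum>i<d. \<Sum>w\<in>W. rigidity_row d x {u, v} (w, i) * a (w, i))"
    by (subst sum.swap) (simp add: sum.cartesian_product)
  also have "\<dots> = (\<Sum>i<d. \<Sum>w\<in>{u, v}. rigidity_row d x {u, v} (w, i) * a (w, i))"
    using assms by (intro sum.cong[OF refl] sum.mono_neutral_right) (auto simp: rigidity_row_pair)
  also have "\<dots> = (\<Sum>i<d. (x u i - x v i) * (a (u, i) - a (v, i)))"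
    using assms by (intro sum.cong[OF refl]) (simp add: rigidity_row_pair algebra_simps)
  finally show ?thesis .
qed

definition on_line :: "('v \<Rightarrow> nat \<Rightarrow> real) \<Rightarrow> ('v \<Rightarrow> nat \<Rightarrow> real) \<Rightarrow> real \<Rightarrow> 'v \<Rightarrow> nat \<Rightarrow> real" where
  "on_line x y t = (\<lambda>v i. x v i + t * (y v i - x v i))"

lemma on_line_0 [simp]: "on_line x y 0 = x" and on_line_1 [simp]: "on_line x y 1 = y"
  by (auto simp: on_line_def)

text \<open>The basic perturbation tool: conditions that each hold somewhere on a line hold together
  at some point, since each loses only finitely many parameters.\<close>

lemma finite_dependent_on_line:
  assumes "finite W" "B \<subseteq> all_pairs W" "indep_family (rigidity_row d (on_line x y s)) B"
  shows "finite {t. \<not> indep_family (rigidity_row d (on_line x y t)) B}"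
proof (rule finite_dependent_pencil[where D = "W \<times> {..<d}" and s = s])
  show "finite (W \<times> {..<d})" using assms(1) by simp
  show "finite B" using assms finite_all_pairs finite_subset by blast
  show "indep_family (rigidity_row d (on_line x y s)) B" by fact
  show "rigidity_row d (on_line x y s) e k = 0" if "e \<in> B" "k \<notin> W \<times> {..<d}" for e k
    using that assms(2) rigidity_row_outside by blast
  show "rigidity_row d (on_line x y t) e k =
      rigidity_row d x e k + t * rigidity_row d (\<lambda>v i. y v i - x v i) e k" for t e k
    unfolding on_line_def by (rule rigidity_row_linear)
qed

section \<open>Trivial motions and the rank bound\<close>

text \<open>The infinitesimal rotations and, for \<open>j = d\<close>, the translations; they are indexed by pairs
  \<open>(j, i)\<close> with \<open>i < j \<le> d\<close>.\<close>

definition trivial_motion ::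
  "nat \<Rightarrow> 'v set \<Rightarrow> ('v \<Rightarrow> nat \<Rightarrow> real) \<Rightarrow> nat \<times> nat \<Rightarrow> 'v \<times> nat \<Rightarrow> real" where
  "trivial_motion d W x = (\<lambda>(j, i) (w, k). if w \<notin> W then 0
     else if k = i then (if j = d then 1 else x w j)
     else if k = j \<and> j < d then - x w i else 0)"

definition motion_index :: "nat \<Rightarrow> (nat \<times> nat) set" where
  "motion_index d = (SIGMA j:{..d}. {..<j})"

lemma finite_motion_index: "finite (motion_index d)"
  by (simp add: motion_index_def)

lemma trivial_motion_outside:
  "p \<in> motion_index d \<Longrightarrow> k \<notin> W \<times> {..<d} \<Longrightarrow> trivial_motion d W x p k = 0"
  by (auto simp: trivial_motion_def motion_index_def split: prod.splits)

text \<open>A translation has equal values at both ends of a pair. For a rotation, the coordinates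
  \<open>i\<close> and \<open>j\<close> contribute the same product of coordinate differences with
  opposite signs.\<close>

lemma trivial_motion_orthogonal:
  assumes "finite W" "e \<in> all_pairs W" "p \<in> motion_index d"
  shows "(\<Sum>k\<in>W \<times> {..<d}. rigidity_row d x e k * trivial_motion d W x p k) = 0"
proof -
  obtain j i where p: "p = (j, i)" "i < j" "j \<le> d" using assms(3) by (auto simp: motion_index_def)
  obtain u v where e: "e = {u, v}" "u \<noteq> v" "u \<in> W" "v \<in> W" using assms(2) by (rule in_all_pairsE)
  let ?f = "\<lambda>k. (x u k - x v k) * (trivial_motion d W x p (u, k) - trivial_motion d W x p (v, k))"
  have f0: "?f k = 0" if "k \<noteq> i" "k \<noteq> j \<or> j = d" for k
    using that e p by (auto simp: trivial_motion_def)
  have "(\<Sum>k<d. ?f k) = 0"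
  proof (cases "j = d")
    case True
    then have "?f i = 0" using p e by (simp add: trivial_motion_def)
    then have "?f k = 0" for k using f0[of k] True by blast
    then show ?thesis by (intro sum.neutral) blast
  next
    case False
    have "(\<Sum>k<d. ?f k) = (\<Sum>k\<in>{i, j}. ?f k)"
      using f0 p False by (intro sum.mono_neutral_right) auto
    also have "\<dots> = 0" using p e False by (simp add: trivial_motion_def algebra_simps)
    finally show ?thesis .
  qed
  then show ?thesis using sum_rigidity_row_mult[OF assms(1) e(3,4,2)] e(1) by simp
qed

text \<open>The vertex \<open>g d\<close> is at the origin, where rotations vanish, so it reads off
  the translation coefficients. With these gone, coordinate \<open>i < l\<close> at
  \<open>g l\<close> sees only the rotation \<open>(l, i)\<close>.\<close>

lemma indep_trivial_motions_simplex:
  assumes "\<And>l. l \<le> d \<Longrightarrow> g l \<in> W" "\<And>l i. l \<le> d \<Longrightarrow> y (g l) i = (if i = l \<and> l < d then 1 else 0)"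
  shows "indep_family (trivial_motion d W y) (motion_index d)"
  unfolding indep_family_def
proof (intro allI impI)
  fix c assume c: "\<forall>k. (\<Sum>p\<in>motion_index d. c p * trivial_motion d W y p k) = 0"
  have trans: "c (d, i) = 0" if "i < d" for i
  proof -
    have "(\<Sum>p\<in>motion_index d. c p * trivial_motion d W y p (g d, i)) =
        (\<Sum>p\<in>motion_index d. if p = (d, i) then c p else 0)"
      using assms[of d] that
      by (intro sum.cong refl) (auto simp: trivial_motion_def motion_index_def split: if_splits)
    also have "\<dots> = c (d, i)"
      using that by (subst sum.delta[OF finite_motion_index]) (auto simp: motion_index_def)
    finally show ?thesis using c by simp
  qed
  have "c (l, i) = 0" if "i < l" "l < d" for i l
  proof -
    have "(\<Sum>p\<in>motion_index d. c p * trivial_motion d W y p (g l, i)) =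
        (\<Sum>p\<in>motion_index d. if p = (l, i) then c p else 0)"
    proof (intro sum.cong refl)
      fix p assume "p \<in> motion_index d"
      then obtain j k where p: "p = (j, k)" "k < j" "j \<le> d" by (auto simp: motion_index_def)
      have "g l \<in> W" using assms that by simp
      then show "c p * trivial_motion d W y p (g l, i) = (if p = (l, i) then c p else 0)"
        using p that assms(2)[of l] trans[of k] by (auto simp: trivial_motion_def)
    qed
    also have "\<dots> = c (l, i)"
      using that by (subst sum.delta[OF finite_motion_index]) (auto simp: motion_index_def)
    finally show ?thesis using c by simp
  qed
  with trans show "\<forall>p\<in>motion_index d. c p = 0"
    by (auto simp: motion_index_def) (metis le_neq_implies_less)
qed

lemma simplex_placement:
  assumes "finite W" "d + 1 \<le> card W"
  obtains g and y :: "'v \<Rightarrow> nat \<Rightarrow> real" where "\<And>l. l \<le> d \<Longrightarrow> g l \<in> W"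
    "\<And>l i. l \<le> d \<Longrightarrow> y (g l) i = (if i = l \<and> l < d then 1 else 0)"
proof -
  obtain h where h: "bij_betw h {..<card W} W"
    using ex_bij_betw_nat_finite[OF assms(1)] by (auto simp: atLeast0LessThan)
  then have inj: "inj_on h {..d}"
    using assms(2) by (auto simp: bij_betw_def elim: inj_on_subset)
  define y :: "'v \<Rightarrow> nat \<Rightarrow> real" where "y = (\<lambda>v i. if i < d \<and> v = h i then 1 else 0)"
  show ?thesis
  proof (rule that[of h y])
    show "h l \<in> W" if "l \<le> d" for l using h that assms(2) by (auto simp: bij_betw_def)
    show "y (h l) i = (if i = l \<and> l < d then 1 else 0)" if "l \<le> d" for l i
      using that inj_onD[OF inj, of l i] by (auto simp: y_def)
  qed
qed

text \<open>Where rows and trivial motions are both independent, orthogonality makes them share the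
  \<open>d * card W\<close> coordinates. At \<open>x\<close> the trivial motions may be dependent,
  when the points lie in a low-dimensional subspace; so \<open>x\<close> is moved towards a simplex,
  which keeps \<open>B\<close> independent for almost all parameters. The motions number
  d(d+1)/2.\<close>

theorem card_indep_rows_le:
  assumes "finite W" "d + 1 \<le> card W" "B \<subseteq> all_pairs W" "indep_family (rigidity_row d x) B"
  shows "card B + card (motion_index d) \<le> d * card W"
proof -
  have finB: "finite B" using assms finite_all_pairs finite_subset by blast
  obtain g and y :: "'a \<Rightarrow> nat \<Rightarrow> real" where g: "\<And>l. l \<le> d \<Longrightarrow> g l \<in> W"
      "\<And>l i. l \<le> d \<Longrightarrow> y (g l) i = (if i = l \<and> l < d then 1 else 0)"
    using simplex_placement[OF assms(1,2)] by metis
  have "finite {t. \<not> indep_family (rigidity_row d (on_line x y t)) B}"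
    using assms by (intro finite_dependent_on_line[where s = 0]) auto
  moreover have "finite {t. \<not> indep_family (trivial_motion d W (on_line x y t)) (motion_index d)}"
  proof (rule finite_dependent_pencil[where D = "W \<times> {..<d}" and s = 1])
    show "finite (W \<times> {..<d})" using assms(1) by simp
    show "finite (motion_index d)" by (rule finite_motion_index)
    show "indep_family (trivial_motion d W (on_line x y 1)) (motion_index d)"
      unfolding on_line_1 using g by (rule indep_trivial_motions_simplex)
    show "trivial_motion d W (on_line x y 1) p k = 0"
      if "p \<in> motion_index d" "k \<notin> W \<times> {..<d}" for p k
      using that by (rule trivial_motion_outside)
    show "trivial_motion d W (on_line x y t) p k = trivial_motion d W x p k +
        t * (trivial_motion d W y p k - trivial_motion d W x p k)" for t p k
      by (auto simp: trivial_motion_def on_line_def algebra_simps split: prod.splits)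
  qed
  ultimately have "finite ({t. \<not> indep_family (rigidity_row d (on_line x y t)) B} \<union>
      {t. \<not> indep_family (trivial_motion d W (on_line x y t)) (motion_index d)})"
    by blast
  then obtain t where "t \<notin> {t. \<not> indep_family (rigidity_row d (on_line x y t)) B} \<union>
      {t. \<not> indep_family (trivial_motion d W (on_line x y t)) (motion_index d)}"
    using infinite_UNIV_char_0 ex_new_if_finite by blast
  then have t: "indep_family (rigidity_row d (on_line x y t)) B"
      "indep_family (trivial_motion d W (on_line x y t)) (motion_index d)" by auto
  let ?f = "case_sum (rigidity_row d (on_line x y t)) (trivial_motion d W (on_line x y t))"
  have fin: "finite (W \<times> {..<d})" using assms(1) by simp
  have indep: "indep_family ?f (B <+> motion_index d)"
    by (rule indep_family_Un_Plus[OF fin finB finite_motion_index _ t])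
      (use assms in \<open>auto intro: rigidity_row_outside trivial_motion_orthogonal\<close>)
  have "card (B <+> motion_index d) \<le> card (W \<times> {..<d})"
  proof (rule card_indep_family_le_support[OF fin _ indep])
    show "finite (B <+> motion_index d)" using finB finite_motion_index by simp
    show "?f p k = 0" if "p \<in> B <+> motion_index d" "k \<notin> W \<times> {..<d}" for p k
      using that assms(3) rigidity_row_outside[of _ W k d] trivial_motion_outside[of _ d k W]
      by (auto simp del: mem_Sigma_iff)
  qed
  then show ?thesis
    using finB finite_motion_index by (simp add: card_Plus card_cartesian_product mult.commute)
qed

text \<open>A placement that maximises the number of independent sets of rows is generic for the
  rigidity matroid, since moving slightly towards another placement destroys none of them.\<close>

theorem matroid_generic_placement_exists:
  assumes "finite V"
  obtains x where "\<And>B y. B \<subseteq> all_pairs V \<Longrightarrow> indep_family (rigidity_row d y) B \<Longrightarrow>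
    indep_family (rigidity_row d x) B"
proof -
  let ?I = "\<lambda>x. {B. B \<subseteq> all_pairs V \<and> indep_family (rigidity_row d x) B}"
  have sub: "?I x \<subseteq> Pow (all_pairs V)" for x by blast
  have fin: "finite (Pow (all_pairs V))" using assms finite_all_pairs by simp
  have finI: "finite (?I x)" for x using sub fin by (rule finite_subset)
  have bound: "card (?I x) < Suc (card (Pow (all_pairs V)))" for x
    using card_mono[OF fin sub] by (simp only: less_Suc_eq_le)
  have "\<exists>x. True \<and> (\<forall>y. True \<longrightarrow> card (?I y) \<le> card (?I x))"
    by (rule ex_has_greatest_nat[where b = "Suc (card (Pow (all_pairs V)))"])
      (use bound in \<open>simp_all only: simp_thms\<close>)
  then obtain x where x: "\<And>y. card (?I y) \<le> card (?I x)" by blast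
  have "indep_family (rigidity_row d x) B"
    if B: "B \<subseteq> all_pairs V" "indep_family (rigidity_row d y) B" for B y
  proof (rule ccontr)
    assume nB: "\<not> indep_family (rigidity_row d x) B"
    have "finite {t. \<not> indep_family (rigidity_row d (on_line x y t)) C}"
      if "C \<in> insert B (?I x)" for C
    proof (cases "C = B")
      case True
      show ?thesis
        unfolding True using assms B by (intro finite_dependent_on_line[where s = 1]) auto
    next
      case False
      then show ?thesis
        using that assms by (intro finite_dependent_on_line[where s = 0]) auto
    qed
    then have "finite (\<Union>C\<in>insert B (?I x). {t. \<not> indep_family (rigidity_row d (on_line x y t)) C})"
      using finI[of x] by blast
    then obtain t where t: "t \<notin> (\<Union>C\<in>insert B (?I x). {t. \<not> indep_family (rigidity_row d (on_line x y t)) C})"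
      using ex_new_if_finite[OF infinite_UNIV_char_0] by blast
    then have "insert B (?I x) \<subseteq> ?I (on_line x y t)" using B(1) by blast
    then have "card (insert B (?I x)) \<le> card (?I (on_line x y t))"
      by (rule card_mono[OF finI])
    moreover have "B \<notin> ?I x" using nB by simp
    ultimately have "card (?I x) < card (?I (on_line x y t))" using finI[of x] by simp
    with x[of "on_line x y t"] show False by simp
  qed
  then show ?thesis by (rule that)
qed

subsection \<open>Generic placements and continuous motions\<close>

lemma countable_poly_mapping:
  assumes "countable A"
  shows "countable {m :: 'a \<Rightarrow>\<^sub>0 'b::{zero,countable}. Poly_Mapping.keys m \<subseteq> A}"
proof -
  define g where "g = (\<lambda>m :: 'a \<Rightarrow>\<^sub>0 'b. (\<lambda>k. (k, Poly_Mapping.lookup m k)) ` Poly_Mapping.keys m)"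
  have "inj g"
  proof (rule injI, rule poly_mapping_eqI)
    fix m n :: "'a \<Rightarrow>\<^sub>0 'b" and k
    assume "g m = g n"
    then have "(k, c) \<in> g m \<longleftrightarrow> (k, c) \<in> g n" for c by simp
    then have "k \<in> Poly_Mapping.keys m \<and> Poly_Mapping.lookup m k = c \<longleftrightarrow>
        k \<in> Poly_Mapping.keys n \<and> Poly_Mapping.lookup n k = c" for c
      by (auto simp: g_def)
    then show "Poly_Mapping.lookup m k = Poly_Mapping.lookup n k"
      by (metis in_keys_iff)
  qed
  moreover have "countable (g ` {m. Poly_Mapping.keys m \<subseteq> A})"
  proof (rule countable_subset)
    show "g ` {m. Poly_Mapping.keys m \<subseteq> A} \<subseteq> {F. F \<subseteq> A \<times> UNIV \<and> finite F}"
      by (auto simp: g_def)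
    show "countable {F :: ('a \<times> 'b) set. F \<subseteq> A \<times> UNIV \<and> finite F}"
      using countable_Collect_finite_subset[of "A \<times> (UNIV :: 'b set)"] assms
      by (simp add: conj_commute)
  qed
  ultimately show ?thesis
    by (metis (no_types, lifting) countable_image_inj_on inj_on_subset subset_UNIV)
qed

text \<open>Evaluating the other variables at \<open>x\<close> turns \<open>P\<close> into a
  polynomial \<open>Q\<close> in the variable \<open>a\<close>. Some coefficient of \<open>Q\<close>
  is the value at \<open>x\<close> of a nonzero rational polynomial over \<open>I\<close>, so
  independence of \<open>x\<close> keeps it nonzero.\<close>

lemma finite_roots_last_variable:
  assumes indep: "algebraically_independent I x" and a: "a \<notin> I" and "P \<noteq> 0"
    and keys: "\<And>m. m \<in> Poly_Mapping.keys P \<Longrightarrow> Poly_Mapping.keys m \<subseteq> insert a I"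
  shows "finite {s. poly_value (x(a := s)) P = 0}"
proof -
  define c where "c = (\<lambda>m. of_rat (Poly_Mapping.lookup P m) *
      (\<Prod>i\<in>Poly_Mapping.keys m - {a}. x i ^ Poly_Mapping.lookup m i) :: real)"
  define Q where "Q = (\<Sum>m\<in>Poly_Mapping.keys P. monom (c m) (Poly_Mapping.lookup m a))"
  have "poly_value (x(a := s)) P = poly Q s" for s
  proof -
    have "(\<Prod>i\<in>Poly_Mapping.keys m. (x(a := s)) i ^ Poly_Mapping.lookup m i) =
        (\<Prod>i\<in>Poly_Mapping.keys m - {a}. x i ^ Poly_Mapping.lookup m i) * s ^ Poly_Mapping.lookup m a" for m
    proof (cases "a \<in> Poly_Mapping.keys m")
      case True
      have "(\<Prod>i\<in>Poly_Mapping.keys m. (x(a := s)) i ^ Poly_Mapping.lookup m i) =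
          s ^ Poly_Mapping.lookup m a *
          (\<Prod>i\<in>Poly_Mapping.keys m - {a}. (x(a := s)) i ^ Poly_Mapping.lookup m i)"
        using True by (subst prod.remove[of _ a]) auto
      also have "(\<Prod>i\<in>Poly_Mapping.keys m - {a}. (x(a := s)) i ^ Poly_Mapping.lookup m i) =
          (\<Prod>i\<in>Poly_Mapping.keys m - {a}. x i ^ Poly_Mapping.lookup m i)"
        by (intro prod.cong) auto
      finally show ?thesis by simp
    next
      case False
      then have "Poly_Mapping.lookup m a = 0" by (simp add: in_keys_iff)
      moreover have "Poly_Mapping.keys m - {a} = Poly_Mapping.keys m" using False by blast
      ultimately show ?thesis using False by (auto intro!: prod.cong)
    qed
    then show ?thesis
      unfolding poly_value_def Q_def poly_sum by (simp add: poly_monom c_def mult.assoc)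
  qed
  moreover have "Q \<noteq> 0"
  proof -
    have "Poly_Mapping.keys P \<noteq> {}" using \<open>P \<noteq> 0\<close> by simp
    then obtain m0 where m0: "m0 \<in> Poly_Mapping.keys P" by blast
    \<comment> \<open>\<open>k\<close> is an exponent of \<open>a\<close> occurring in
      \<open>P\<close>, and \<open>R\<close> is the coefficient of that power. \<open>strip\<close>
      erases \<open>a\<close> from a monomial; on monomials with equal exponent of \<open>a\<close>
      it is injective, so no terms merge.\<close>
    define k where "k = Poly_Mapping.lookup m0 a"
    define S where "S = {m \<in> Poly_Mapping.keys P. Poly_Mapping.lookup m a = k}"
    define strip where "strip = (\<lambda>m. Poly_Mapping.update a (0::nat) m)"
    define R where "R = (\<Sum>m\<in>S. Poly_Mapping.single (strip m) (Poly_Mapping.lookup P m))"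
    have finS: "finite S" by (simp add: S_def)
    have inj: "inj_on strip S"
    proof (rule inj_onI, rule poly_mapping_eqI)
      fix m n i assume "m \<in> S" "n \<in> S" and eq: "strip m = strip n"
      then have "Poly_Mapping.lookup m a = Poly_Mapping.lookup n a" by (simp add: S_def)
      moreover have "Poly_Mapping.lookup (strip m) i = Poly_Mapping.lookup (strip n) i" using eq by simp
      ultimately show "Poly_Mapping.lookup m i = Poly_Mapping.lookup n i"
        by (cases "i = a") (auto simp: strip_def lookup_update)
    qed
    have R: "Poly_Mapping.lookup R (strip m) = Poly_Mapping.lookup P m" if "m \<in> S" for m
    proof -
      have "Poly_Mapping.lookup R (strip m) =
          (\<Sum>n\<in>S. if n = m then Poly_Mapping.lookup P n else 0)"
        unfolding R_def lookup_sum lookup_single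
        using that inj by (intro sum.cong) (auto simp: when_def dest: inj_onD)
      then show ?thesis using that finS by simp
    qed
    have keysR: "Poly_Mapping.keys R = strip ` S"
    proof
      show "Poly_Mapping.keys R \<subseteq> strip ` S"
        unfolding R_def by (rule order.trans[OF keys_sum]) auto
      show "strip ` S \<subseteq> Poly_Mapping.keys R"
        using R by (auto simp: S_def in_keys_iff)
    qed
    have strip: "Poly_Mapping.keys (strip m) = Poly_Mapping.keys m - {a}" for m
      by (simp add: strip_def keys_update)
    have "m0 \<in> S" using m0 by (simp add: S_def k_def)
    then have "R \<noteq> 0" using keysR by auto
    moreover have "\<forall>m\<in>Poly_Mapping.keys R. Poly_Mapping.keys m \<subseteq> I"
      unfolding keysR using strip keys by (auto simp: S_def)
    ultimately have "poly_value x R \<noteq> 0"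
      using indep unfolding algebraically_independent_def by blast
    moreover have "poly_value x R = (\<Sum>m\<in>S. c m)"
      unfolding poly_value_def keysR sum.reindex[OF inj] c_def
    proof (intro sum.cong refl)
      fix m assume "m \<in> S"
      have "(\<Prod>i\<in>Poly_Mapping.keys (strip m). x i ^ Poly_Mapping.lookup (strip m) i) =
          (\<Prod>i\<in>Poly_Mapping.keys m - {a}. x i ^ Poly_Mapping.lookup m i)"
        unfolding strip by (intro prod.cong refl) (auto simp: strip_def lookup_update)
      then show "((\<lambda>m. of_rat (Poly_Mapping.lookup R m) *
            (\<Prod>i\<in>Poly_Mapping.keys m. x i ^ Poly_Mapping.lookup m i)) \<circ> strip) m =
          of_rat (Poly_Mapping.lookup P m) *
            (\<Prod>i\<in>Poly_Mapping.keys m - {a}. x i ^ Poly_Mapping.lookup m i)"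
        by (simp only: o_apply R[OF \<open>m \<in> S\<close>])
    qed
    moreover have "coeff Q k = (\<Sum>m\<in>S. c m)"
      unfolding Q_def coeff_sum S_def by (subst sum.inter_filter) (auto intro!: sum.cong)
    ultimately show ?thesis by auto
  qed
  ultimately show ?thesis using poly_roots_finite[of Q] by simp
qed

text \<open>There are countably many rational polynomials in finitely many variables, and each
  nonzero one excludes finitely many values of the new coordinate.\<close>

lemma algebraically_independent_insert:
  assumes "finite I" "algebraically_independent I x" "a \<notin> I"
  shows "countable {s. \<not> algebraically_independent (insert a I) (x(a := s))}"
proof -
  let ?M = "{m :: 'a \<Rightarrow>\<^sub>0 nat. Poly_Mapping.keys m \<subseteq> insert a I}"
  let ?P = "{P :: ('a \<Rightarrow>\<^sub>0 nat) \<Rightarrow>\<^sub>0 rat. Poly_Mapping.keys P \<subseteq> ?M}"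
  have "countable ?M" using assms(1) by (intro countable_poly_mapping countable_finite) simp
  then have "countable ?P" by (rule countable_poly_mapping)
  moreover have "countable {s. poly_value (x(a := s)) P = 0}" if "P \<in> ?P - {0}" for P
    using that by (intro countable_finite finite_roots_last_variable[OF assms(2,3)]) auto
  ultimately have "countable (\<Union>P\<in>?P - {0}. {s. poly_value (x(a := s)) P = 0})"
    by (intro countable_UN) auto
  then show ?thesis
    by (rule countable_subset[rotated]) (auto simp: algebraically_independent_def)
qed

text \<open>Coordinates are adjusted one at a time. Each new value must avoid a countable set for
  algebraic independence and a finite set for the rows of \<open>B\<close>, and the reals are
  uncountable.\<close>

lemma generic_placement_exists:
  assumes "finite V" "B \<subseteq> all_pairs V" "indep_family (rigidity_row d x) B"
  obtains pos where "\<And>v i. d \<le> i \<Longrightarrow> pos v i = 0" "generic d V pos"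
    "indep_family (rigidity_row d pos) B"
proof -
  have "\<exists>y. algebraically_independent I (\<lambda>(v, i). y v i) \<and> indep_family (rigidity_row d y) B"
    if "finite I" for I
    using that
  proof (induction I rule: finite_induct)
    case empty
    have "P = 0" if "\<forall>m\<in>Poly_Mapping.keys P. Poly_Mapping.keys m \<subseteq> {}" "poly_value z P = 0"
      for P :: "('a \<times> nat \<Rightarrow>\<^sub>0 nat) \<Rightarrow>\<^sub>0 rat" and z
    proof -
      have "Poly_Mapping.keys P \<subseteq> {0}" using that(1) by auto
      then have "poly_value z P = (\<Sum>m\<in>{0}. of_rat (Poly_Mapping.lookup P m) *
          (\<Prod>i\<in>Poly_Mapping.keys m. z i ^ Poly_Mapping.lookup m i))"
        unfolding poly_value_def by (intro sum.mono_neutral_left) (auto simp: in_keys_iff)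
      then have "Poly_Mapping.lookup P 0 = 0" using that(2) by simp
      then have "0 \<notin> Poly_Mapping.keys P" by (simp add: in_keys_iff)
      with \<open>Poly_Mapping.keys P \<subseteq> {0}\<close> have "Poly_Mapping.keys P = {}" by blast
      then show "P = 0" by simp
    qed
    then show ?case using assms(3) unfolding algebraically_independent_def by blast
  next
    case (insert a I)
    obtain y where y: "algebraically_independent I (\<lambda>(v, i). y v i)" "indep_family (rigidity_row d y) B"
      using insert.IH by blast
    obtain w j where a: "a = (w, j)" by fastforce
    let ?z = "\<lambda>t v i. if (v, i) = (w, j) then t else y v i"
    let ?z' = "\<lambda>v i. if (v, i) = (w, j) then y w j + 1 else y v i"
    have line: "on_line y ?z' t = ?z (y w j + t)" for t
      by (auto simp: on_line_def fun_eq_iff)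
    have "finite {t. \<not> indep_family (rigidity_row d (on_line y ?z' t)) B}"
      using assms y by (intro finite_dependent_on_line[where s = 0]) auto
    then have "finite ((\<lambda>t. y w j + t) ` {t. \<not> indep_family (rigidity_row d (on_line y ?z' t)) B})"
      by simp
    moreover have "{t. \<not> indep_family (rigidity_row d (?z t)) B} \<subseteq>
        (\<lambda>t. y w j + t) ` {t. \<not> indep_family (rigidity_row d (on_line y ?z' t)) B}"
    proof
      fix t
      have shift: "y w j + (t - y w j) = t" by simp
      assume "t \<in> {t. \<not> indep_family (rigidity_row d (?z t)) B}"
      then have "t - y w j \<in> {t. \<not> indep_family (rigidity_row d (on_line y ?z' t)) B}"
        using shift by (simp only: line mem_Collect_eq simp_thms)
      then show "t \<in> (\<lambda>t. y w j + t) ` {t. \<not> indep_family (rigidity_row d (on_line y ?z' t)) B}"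
        by (intro image_eqI[of _ _ "t - y w j"]) auto
    qed
    ultimately have "countable {t. \<not> indep_family (rigidity_row d (?z t)) B}"
      using countable_finite finite_subset by blast
    moreover have upd: "(\<lambda>(v, i). y v i)(a := t) = (\<lambda>(v, i). ?z t v i)" for t
      by (auto simp: a fun_eq_iff)
    have "countable {t. \<not> algebraically_independent (insert a I) (\<lambda>(v, i). ?z t v i)}"
      using algebraically_independent_insert[OF insert.hyps(1) y(1) insert.hyps(2)] unfolding upd .
    ultimately have "countable ({t. \<not> indep_family (rigidity_row d (?z t)) B} \<union>
        {t. \<not> algebraically_independent (insert a I) (\<lambda>(v, i). ?z t v i)})"
      by simp
    then have "{t. \<not> indep_family (rigidity_row d (?z t)) B} \<union>
        {t. \<not> algebraically_independent (insert a I) (\<lambda>(v, i). ?z t v i)} \<noteq> UNIV"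
      using uncountable_UNIV_real by metis
    then obtain t where "indep_family (rigidity_row d (?z t)) B"
        "algebraically_independent (insert a I) (\<lambda>(v, i). ?z t v i)"
      by auto
    then show ?case by blast
  qed
  from this[of "V \<times> {..<d}"] assms(1) obtain y
    where y: "algebraically_independent (V \<times> {..<d}) (\<lambda>(v, i). y v i)" "indep_family (rigidity_row d y) B"
    by auto
  \<comment> \<open>Points of \<open>Euclidean_space d\<close> vanish from index \<open>d\<close>
    on. The rows and the polynomials over \<open>V \<times> {..<d}\<close> only see smaller
    indices.\<close>
  define pos where "pos = (\<lambda>v i. if i < d then y v i else 0)"
  show ?thesis
  proof (rule that[of pos])
    show "pos v i = 0" if "d \<le> i" for v i using that by (simp add: pos_def)
    have "poly_value (\<lambda>(v, i). pos v i) P = poly_value (\<lambda>(v, i). y v i) P"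
      if "\<forall>m\<in>Poly_Mapping.keys P. Poly_Mapping.keys m \<subseteq> V \<times> {..<d}" for P
      unfolding poly_value_def
    proof (intro sum.cong refl arg_cong2[of _ _ _ _ "(*)"] prod.cong)
      fix m k assume "m \<in> Poly_Mapping.keys P" "k \<in> Poly_Mapping.keys m"
      then have "k \<in> V \<times> {..<d}" using that by blast
      then show "(case k of (v, i) \<Rightarrow> pos v i) ^ Poly_Mapping.lookup m k =
          (case k of (v, i) \<Rightarrow> y v i) ^ Poly_Mapping.lookup m k"
        by (auto simp: pos_def)
    qed
    then show "generic d V pos"
      using y(1) unfolding generic_def algebraically_independent_def by simp
    show "indep_family (rigidity_row d pos) B"
      using y(2) indep_family_cong[of B "rigidity_row d pos" "rigidity_row d y"]
        rigidity_row_cong[of _ d pos y] by (simp add: pos_def)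
  qed
qed

section \<open>From full rank to rigidity under continuous motions\<close>

definition sq_dist :: "nat \<Rightarrow> (nat \<Rightarrow> real) \<Rightarrow> (nat \<Rightarrow> real) \<Rightarrow> real" where
  "sq_dist d x y = (\<Sum>i<d. (x i - y i)\<^sup>2)"

lemma edist_eq_iff: "edist d x y = edist d z w \<longleftrightarrow> sq_dist d x y = sq_dist d z w"
  by (simp add: edist_def L2_set_def sq_dist_def)

text \<open>Polarisation: at a common vertex \<open>w\<close> the two blocks are difference vectors,
  whose inner product is determined by three squared distances.\<close>

lemma rigidity_row_inner:
  assumes "e \<in> all_pairs W" "f \<in> all_pairs W"
    and "\<And>u v. u \<in> W \<Longrightarrow> v \<in> W \<Longrightarrow> sq_dist d (x u) (x v) = sq_dist d (y u) (y v)"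
  shows "(\<Sum>i<d. rigidity_row d x e (w, i) * rigidity_row d x f (w, i)) =
    (\<Sum>i<d. rigidity_row d y e (w, i) * rigidity_row d y f (w, i))"
proof (cases "w \<in> e \<and> w \<in> f")
  case False
  then show ?thesis by (auto simp: rigidity_row_def intro!: sum.cong)
next
  case True
  obtain a where e: "e = {w, a}" "w \<noteq> a" "w \<in> W" "a \<in> W"
    using assms(1) True by (elim in_all_pairsE) (auto simp: insert_commute)
  obtain b where f: "f = {w, b}" "w \<noteq> b" "b \<in> W"
    using assms(2) True by (elim in_all_pairsE) (auto simp: insert_commute)
  have inner: "(\<Sum>i<d. rigidity_row d z e (w, i) * rigidity_row d z f (w, i)) =
      (sq_dist d (z w) (z a) + sq_dist d (z w) (z b) - sq_dist d (z a) (z b)) / 2" for z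
    unfolding e f sq_dist_def sum.distrib[symmetric] sum_subtractf[symmetric] sum_divide_distrib
    using e f by (intro sum.cong) (auto simp: rigidity_row_pair power2_eq_square field_simps)
  show ?thesis unfolding inner using assms(3) e f by simp
qed

text \<open>A combination of rows vanishes at a vertex exactly when its squared norm there does, and
  this norm is a quadratic form in inner products that depend on distances only. This avoids
  extending the correspondence of points to an isometry of space.\<close>

lemma indep_rows_isometric:
  assumes "finite W" "B \<subseteq> all_pairs W" "indep_family (rigidity_row d x) B"
    and "\<And>u v. u \<in> W \<Longrightarrow> v \<in> W \<Longrightarrow> sq_dist d (x u) (x v) = sq_dist d (y u) (y v)"
  shows "indep_family (rigidity_row d y) B"
  unfolding indep_family_def
proof (intro allI impI)
  fix c assume c: "\<forall>k. (\<Sum>e\<in>B. c e * rigidity_row d y e k) = 0"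
  have sq: "(\<Sum>i<d. (\<Sum>e\<in>B. c e * rigidity_row d z e (w, i)) * (\<Sum>e\<in>B. c e * rigidity_row d z e (w, i))) =
      (\<Sum>e\<in>B. \<Sum>f\<in>B. c e * c f * (\<Sum>i<d. rigidity_row d z e (w, i) * rigidity_row d z f (w, i)))"
    for z and w
  proof -
    have "(\<Sum>i<d. (\<Sum>e\<in>B. c e * rigidity_row d z e (w, i)) * (\<Sum>e\<in>B. c e * rigidity_row d z e (w, i))) =
        (\<Sum>i<d. \<Sum>e\<in>B. \<Sum>f\<in>B. c e * c f * (rigidity_row d z e (w, i) * rigidity_row d z f (w, i)))"
      by (intro sum.cong refl) (simp add: sum_product mult_ac)
    also have "\<dots> = (\<Sum>e\<in>B. \<Sum>f\<in>B. \<Sum>i<d. c e * c f * (rigidity_row d z e (w, i) * rigidity_row d z f (w, i)))"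
      by (subst sum.swap, rule sum.cong[OF refl], subst sum.swap) simp
    finally show ?thesis by (simp add: sum_distrib_left)
  qed
  have "(\<Sum>e\<in>B. c e * rigidity_row d x e (w, i)) = 0" for w i
  proof (cases "i < d")
    case False
    then show ?thesis by (simp add: rigidity_row_def)
  next
    case True
    have "(\<Sum>i<d. (\<Sum>e\<in>B. c e * rigidity_row d x e (w, i)) * (\<Sum>e\<in>B. c e * rigidity_row d x e (w, i))) =
        (\<Sum>i<d. (\<Sum>e\<in>B. c e * rigidity_row d y e (w, i)) * (\<Sum>e\<in>B. c e * rigidity_row d y e (w, i)))"
      unfolding sq
    proof (rule sum.cong[OF refl], rule sum.cong[OF refl])
      fix e f assume "e \<in> B" "f \<in> B"
      then have "e \<in> all_pairs W" "f \<in> all_pairs W" using assms(2) by auto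
      from rigidity_row_inner[OF this assms(4)]
      show "c e * c f * (\<Sum>i<d. rigidity_row d x e (w, i) * rigidity_row d x f (w, i)) =
          c e * c f * (\<Sum>i<d. rigidity_row d y e (w, i) * rigidity_row d y f (w, i))"
        by (rule arg_cong)
    qed
    also have "\<dots> = 0" using c by simp
    finally show ?thesis using True by (subst (asm) sum_nonneg_eq_0_iff) auto
  qed
  then show "\<forall>e\<in>B. c e = 0"
    using indep_familyD[OF assms(3), of c] by auto
qed

text \<open>The difference of two placements with equal edge lengths is an infinitesimal motion of
  their midpoint.\<close>

lemma midpoint_motion:
  "(\<Sum>i<d. ((a u i + b u i) / 2 - (a v i + b v i) / 2) * ((a u i - b u i) - (a v i - b v i))) =
    (sq_dist d (a u) (a v) - sq_dist d (b u) (b v)) / 2"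
  unfolding sq_dist_def sum_subtractf[symmetric] sum_divide_distrib
  by (intro sum.cong refl) (simp add: power2_eq_square field_simps)

text \<open>By the rank bound, the rows of \<open>B\<close> at the midpoint span every row over
  \<open>W\<close>. The difference of \<open>a\<close> and \<open>b\<close> is orthogonal to the
  rows of \<open>B\<close>, hence to the row of \<open>{u, v}\<close>, and that pairing is half the
  difference of the squared distances.\<close>

lemma distances_preserved:
  assumes "finite W" "d + 1 \<le> card W" "B \<subseteq> all_pairs W"
    and card: "d * card W \<le> card B + card (motion_index d)"
    and indep: "indep_family (rigidity_row d (\<lambda>v i. (a v i + b v i) / 2)) B"
    and edges: "\<And>u v. {u, v} \<in> B \<Longrightarrow> sq_dist d (a u) (a v) = sq_dist d (b u) (b v)"
    and uv: "u \<in> W" "v \<in> W"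
  shows "sq_dist d (a u) (a v) = sq_dist d (b u) (b v)"
proof (cases "u = v")
  case True
  then show ?thesis by (simp add: sq_dist_def)
next
  case False
  let ?r = "rigidity_row d (\<lambda>v i. (a v i + b v i) / 2)"
  define w where "w = (\<lambda>(v, i). a v i - b v i)"
  have finB: "finite B" using assms finite_all_pairs finite_subset by blast
  have pairing: "(\<Sum>k\<in>W \<times> {..<d}. ?r {u, v} k * w k) = (sq_dist d (a u) (a v) - sq_dist d (b u) (b v)) / 2"
    if "u \<in> W" "v \<in> W" "u \<noteq> v" for u v
    using that assms(1) by (simp add: sum_rigidity_row_mult w_def midpoint_motion)
  have "?r {u, v} \<in> family_span ?r B"
  proof (cases "{u, v} \<in> B")
    case True
    then show ?thesis using finB by (rule family_span_base[rotated])
  next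
    case nB: False
    have "\<not> indep_family ?r (insert {u, v} B)"
    proof
      assume "indep_family ?r (insert {u, v} B)"
      moreover have "insert {u, v} B \<subseteq> all_pairs W"
        using assms(3) uv False by (simp add: pair_in_all_pairs)
      ultimately have "card (insert {u, v} B) + card (motion_index d) \<le> d * card W"
        using assms(1,2) by (intro card_indep_rows_le)
      then show False using card nB finB by simp
    qed
    then show ?thesis using family_span_if_dependent_insert[OF finB indep] by blast
  qed
  then obtain c where c: "\<And>k. ?r {u, v} k = (\<Sum>f\<in>B. c f * ?r f k)"
    unfolding family_span_def by blast
  have "(\<Sum>k\<in>W \<times> {..<d}. ?r {u, v} k * w k) = (\<Sum>f\<in>B. c f * (\<Sum>k\<in>W \<times> {..<d}. ?r f k * w k))"
    unfolding c sum_distrib_right sum_distrib_left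
    by (subst sum.swap) (simp add: mult.assoc)
  also have "\<dots> = 0"
  proof (intro sum.neutral ballI)
    fix f assume "f \<in> B"
    then have "f \<in> all_pairs W" using assms(3) by blast
    then obtain s t where "f = {s, t}" "s \<noteq> t" "s \<in> W" "t \<in> W" by (rule in_all_pairsE)
    then show "c f * (\<Sum>k\<in>W \<times> {..<d}. ?r f k * w k) = 0"
      using pairing[of s t] edges[of s t] \<open>f \<in> B\<close> by simp
  qed
  finally show ?thesis using pairing[OF uv False] by simp
qed

text \<open>The motion is only continuous and cannot be differentiated. Instead, the set
  \<open>S\<close> of times at which all distances have their initial values is open and closed in
  the interval; openness compares two nearby times through their midpoint, where \<open>B\<close> is
  still independent.\<close>

lemma d_rigid_if_independent_rows:
  assumes "finite W" "d + 1 \<le> card W" "E \<subseteq> all_pairs W" "B \<subseteq> E"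
    and indep: "indep_family (rigidity_row d x) B"
    and card: "d * card W \<le> card B + card (motion_index d)"
  shows "d_rigid d W E"
proof -
  have BW: "B \<subseteq> all_pairs W" using assms by blast
  then have finB: "finite B" using assms(1) finite_all_pairs finite_subset by blast
  obtain pos where pos: "\<And>v i. d \<le> i \<Longrightarrow> pos v i = 0" "generic d W pos"
      "indep_family (rigidity_row d pos) B"
    using generic_placement_exists[OF assms(1) BW indep] by blast
  have "framework d W E pos"
    using assms pos(1) by (auto simp: framework_def simple_graph_def topspace_Euclidean_space all_pairs_def)
  moreover have "rigid d W E pos"
    unfolding rigid_def edist_eq_iff
  proof (intro allI impI)
    fix q assume motion: "continuous_motion d W pos q"
      and edges: "\<forall>t\<in>{0..1}. \<forall>u\<in>W. \<forall>v\<in>W. {u, v} \<in> E \<longrightarrow>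
        sq_dist d (q t u) (q t v) = sq_dist d (pos u) (pos v)"
    have cont: "continuous_on {0..1} (\<lambda>t. q t v i)" if "v \<in> W" for v i
    proof -
      have "continuous_map (top_of_set {0..1}) (Euclidean_space d) (\<lambda>t. q t v)"
        using motion that by (simp add: continuous_motion_def)
      then have "continuous_map (top_of_set {0..1}) euclideanreal (\<lambda>t. q t v i)"
        unfolding Euclidean_space_def continuous_map_in_subtopology continuous_map_componentwise_UNIV
        by blast
      then show ?thesis by simp
    qed
    define S where "S = {t \<in> {0..1}. \<forall>u\<in>W. \<forall>v\<in>W. sq_dist d (q t u) (q t v) = sq_dist d (pos u) (pos v)}"
    have "0 \<in> S"
      using motion by (simp add: S_def continuous_motion_def)
    moreover have "closedin (top_of_set {0..1}) S"
    proof -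
      have "closedin (top_of_set {0..1}) {t \<in> {0..1}. sq_dist d (q t u) (q t v) = sq_dist d (pos u) (pos v)}"
        if "u \<in> W" "v \<in> W" for u v
        unfolding sq_dist_def using that
        by (intro continuous_closedin_preimage_constant continuous_intros cont)
      moreover have "S = {0..1} \<inter> (\<Inter>u\<in>W. \<Inter>v\<in>W. {t \<in> {0..1}. sq_dist d (q t u) (q t v) = sq_dist d (pos u) (pos v)})"
        by (auto simp: S_def)
      moreover have "W \<noteq> {}" using assms(2) by auto
      ultimately show ?thesis by (simp add: closedin_Int closedin_INT)
    qed
    moreover have "openin (top_of_set {0..1}) S"
      unfolding openin_euclidean_subtopology_iff
    proof (intro conjI ballI)
      show "S \<subseteq> {0..1}" by (auto simp: S_def)
      fix s assume s: "s \<in> S"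
      let ?m = "\<lambda>t v i. (q t v i + q s v i) / 2"
      \<comment> \<open>\<open>q s\<close> need not be generic, but it has the distances of
        \<open>pos\<close>, and these decide independence.\<close>
      have "indep_family (rigidity_row d (q s)) B"
        using s by (intro indep_rows_isometric[OF assms(1) BW pos(3)]) (simp add: S_def)
      then have "\<forall>\<^sub>F t in at s within {0..1}. indep_family (rigidity_row d (?m t)) B"
      proof (rule eventually_indep_family[where D = "W \<times> {..<d}", rotated 2])
        show "finite (W \<times> {..<d})" using assms(1) by simp
        show "finite B" by (rule finB)
        show "rigidity_row d (q s) e k = 0" if "e \<in> B" "k \<notin> W \<times> {..<d}" for e k
          using that BW rigidity_row_outside by blast
        fix e k assume e: "e \<in> B" and k: "k \<in> W \<times> {..<d}"
        have lim: "((\<lambda>t. ?m t v i) \<longlongrightarrow> q s v i) (at s within {0..1})" if "v \<in> W" for v i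
        proof -
          have "((\<lambda>t. q t v i) \<longlongrightarrow> q s v i) (at s within {0..1})"
            using cont[OF that] s by (simp add: continuous_on_def S_def)
          then have "((\<lambda>t. ?m t v i) \<longlongrightarrow> (q s v i + q s v i) / 2) (at s within {0..1})"
            by (intro tendsto_intros) auto
          then show ?thesis by simp
        qed
        have "e \<subseteq> W" using e BW by (auto simp: all_pairs_def)
        obtain w i where k': "k = (w, i)" by fastforce
        show "((\<lambda>t. rigidity_row d (?m t) e k) \<longlongrightarrow> rigidity_row d (q s) e k) (at s within {0..1})"
        proof (cases "w \<in> e \<and> i < d")
          case True
          have "((\<lambda>t. \<Sum>z\<in>e. ?m t w i - ?m t z i) \<longlongrightarrow> (\<Sum>z\<in>e. q s w i - q s z i)) (at s within {0..1})"
            using True \<open>e \<subseteq> W\<close> by (intro tendsto_sum tendsto_diff lim) auto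
          then show ?thesis using True by (simp add: rigidity_row_def k')
        next
          case False
          then show ?thesis by (auto simp: rigidity_row_def k')
        qed
      qed
      then obtain \<delta> where \<delta>: "\<delta> > 0" "\<And>t. t \<in> {0..1} \<Longrightarrow> t \<noteq> s \<Longrightarrow> dist t s < \<delta> \<Longrightarrow>
          indep_family (rigidity_row d (?m t)) B"
        unfolding eventually_at by blast
      have "t \<in> S" if t: "t \<in> {0..1}" "dist t s < \<delta>" for t
      proof (cases "t = s")
        case True
        then show ?thesis using s by simp
      next
        case False
        have "sq_dist d (q t u) (q t v) = sq_dist d (q s u) (q s v)" if "u \<in> W" "v \<in> W" for u v
        proof (rule distances_preserved[OF assms(1,2) BW card \<delta>(2)[OF t(1) False t(2)] _ that])
          fix u v assume "{u, v} \<in> B"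
          then have "{u, v} \<in> E" "u \<in> W" "v \<in> W"
            using assms(4) BW by (auto simp: all_pairs_def)
          then show "sq_dist d (q t u) (q t v) = sq_dist d (q s u) (q s v)"
            using edges t(1) s by (simp add: S_def)
        qed
        then show ?thesis using s t(1) by (simp add: S_def)
      qed
      then show "\<exists>e>0. \<forall>t\<in>{0..1}. dist t s < e \<longrightarrow> t \<in> S" using \<delta>(1) by blast
    qed
    ultimately have "S = {0..1}"
      using connected_Icc[of 0 "1::real"] unfolding connected_clopen by blast
    then show "\<forall>t\<in>{0..1}. \<forall>u\<in>W. \<forall>v\<in>W. sq_dist d (q t u) (q t v) = sq_dist d (pos u) (pos v)"
      by (auto simp: S_def)
  qed
  ultimately show ?thesis using pos(2) unfolding d_rigid_def by blast
qed

subsection \<open>Independent rows from labellings and extensions\<close>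

text \<open>Put the label class \<open>i < d\<close> at the \<open>i\<close>-th unit vector and the class \<open>d\<close> at the origin. The
  row of an edge between the classes \<open>i\<close> and \<open>j\<close> then only involves the components of its end
  points in direction \<open>i - j\<close>, so the rows between two classes behave like the incidence vectors of
  a connected bipartite graph, which leave one degree of freedom per pair of classes.\<close>

lemma independent_rows_if_labelled:
  fixes W :: "'v set"
  assumes "finite W" "W \<noteq> {}" "H \<subseteq> all_pairs W"
    and lab: "\<And>u v j. u \<in> W \<Longrightarrow> v \<in> W \<Longrightarrow> j \<le> d \<Longrightarrow>
      \<exists>z\<in>W. lab z = j \<and> {u, z} \<in> H \<and> {v, z} \<in> H"
    and lab_le: "\<And>u. u \<in> W \<Longrightarrow> lab u \<le> d"
  obtains x B where "B \<subseteq> H" "indep_family (rigidity_row d x) B"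
    "d * card W \<le> card B + card (motion_index d)"
proof -
  define x where "x = (\<lambda>(v::'v) i. if lab v = i then 1 else (0::real))"
  \<comment> \<open>\<open>f u j\<close> is the half at \<open>u\<close> of the row of an edge from
    \<open>u\<close> to class \<open>j\<close>; it is the same for every end vertex in that
    class.\<close>
  define f where "f = (\<lambda>u j (w::'v, i). if w = u \<and> i < d then x u i - (if i = j then 1 else 0) else 0)"
  have row: "rigidity_row d x {u, v} k = f u (lab v) k + f v (lab u) k" if "u \<noteq> v" for u v k
    using that by (cases k) (auto simp: rigidity_row_pair f_def x_def)
  obtain u0 where "u0 \<in> W" using assms(2) by blast
  then have "\<forall>j\<in>{..d}. \<exists>z. z \<in> W \<and> lab z = j" using lab[of u0 u0] by auto
  then obtain root where root: "\<And>j. j \<le> d \<Longrightarrow> root j \<in> W \<and> lab (root j) = j"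
    by (metis atMost_iff)
  have "finite H" using assms finite_all_pairs finite_subset by blast
  then obtain B where B: "B \<subseteq> H" "indep_family (rigidity_row d x) B"
      "\<And>e. e \<in> H \<Longrightarrow> rigidity_row d x e \<in> family_span (rigidity_row d x) B"
    using family_basis_exists by blast
  have finB: "finite B" using B(1) \<open>finite H\<close> finite_subset by blast
  \<comment> \<open>One representative per class supplies its half rows towards the lower classes,
    \<open>card (motion_index d)\<close> in all. Together with the rows of \<open>B\<close> they
    turn out to span all coordinates over \<open>W\<close>.\<close>
  let ?g = "case_sum (rigidity_row d x) (\<lambda>(j, i). f (root j) i)"
  define S where "S = family_span ?g (B <+> motion_index d)"
  have finS: "finite (B <+> motion_index d)" using finB finite_motion_index by simp
  have base: "?g p \<in> S" if "p \<in> B <+> motion_index d" for p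
    unfolding S_def using finS that by (rule family_span_base)
  have rowS: "rigidity_row d x e \<in> S" if "e \<in> H" for e
    unfolding S_def
  proof (rule family_span_trans[OF finB _ B(3)[OF that]])
    show "rigidity_row d x e \<in> family_span ?g (B <+> motion_index d)" if "e \<in> B" for e
      using base[OF InlI[OF that]] by (simp add: S_def)
  qed
  have transfer: "f v (lab u) \<in> S" if "f u (lab v) \<in> S" "{u, v} \<in> H" for u v
  proof -
    have "u \<noteq> v" using that(2) assms(3) by (auto simp: all_pairs_def)
    then have "f v (lab u) k = 1 * rigidity_row d x {u, v} k + (-1) * f u (lab v) k" for k
      by (simp add: row)
    then show ?thesis
      using family_span_lincomb[of "rigidity_row d x {u, v}" ?g "B <+> motion_index d" "f u (lab v)"]
        rowS[OF that(2)] that(1) unfolding S_def by blast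
  qed
  \<comment> \<open>The root of the class of \<open>u\<close> shares a neighbour of class
    \<open>i\<close> with \<open>u\<close>; two transfers carry the half row from the root over that
    neighbour to \<open>u\<close>.\<close>
  have below: "f u i \<in> S" if u: "u \<in> W" and i: "i < lab u" for u i
  proof -
    let ?j = "lab u"
    have j: "?j \<le> d" using lab_le u by blast
    have r: "f (root ?j) i \<in> S"
      using base[OF InrI[of "(?j, i)"]] i j by (simp add: motion_index_def)
    obtain z where z: "z \<in> W" "lab z = i" "{root ?j, z} \<in> H" "{u, z} \<in> H"
      using lab[of "root ?j" u i] root[OF j] u i j by auto
    have "f z (lab (root ?j)) \<in> S" using transfer[of "root ?j" z] r z by simp
    then have "f z (lab u) \<in> S" using root[OF j] by simp
    then have "f u (lab z) \<in> S" using z(4) transfer[of z u] by (simp add: insert_commute)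
    then show ?thesis using z by simp
  qed
  have all: "f u j \<in> S" if u: "u \<in> W" and j: "j \<le> d" "j \<noteq> lab u" for u j
  proof (cases "j < lab u")
    case True
    then show ?thesis using below u by blast
  next
    case False
    then have "lab u < j" using j by simp
    obtain z where z: "z \<in> W" "lab z = j" "{u, z} \<in> H" using lab[OF u u j(1)] by blast
    have "f z (lab u) \<in> S" using below[OF z(1)] z(2) \<open>lab u < j\<close> by simp
    then have "f u (lab z) \<in> S" using transfer[of z u] z by (simp add: insert_commute)
    then show ?thesis using z by simp
  qed
  have "card (W \<times> {..<d}) \<le> card (B <+> motion_index d)"
  proof (rule card_indep_family_le[OF _ finS indep_family_unit])
    show "finite (W \<times> {..<d})" using assms(1) by simp
    then show "finite (W \<times> {..<d})" .
    fix p assume "p \<in> W \<times> {..<d}"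
    then obtain u k where p: "p = (u, k)" "u \<in> W" "k < d" by blast
    \<comment> \<open>At the origin \<open>f u k\<close> is minus the wanted unit vector; at the
      \<open>k\<close>-th unit vector \<open>f u d\<close> is the wanted one; elsewhere the position
      of \<open>u\<close> cancels in \<open>f u d - f u k\<close>.\<close>
    let ?e = "\<lambda>q. if q = p then 1 else (0::real)"
    have "?e \<in> S"
    proof -
      consider "lab u = d" | "lab u = k" | "lab u < d" "lab u \<noteq> k"
        using lab_le[OF p(2)] by linarith
      then show ?thesis
      proof cases
        case 1
        then have "f u k \<in> S" "f u k \<in> S" using all p by auto
        moreover have "?e q = (-1) * f u k q + 0 * f u k q" for q
          using p 1 by (cases q) (auto simp: f_def x_def)
        ultimately show ?thesis unfolding S_def by (rule family_span_lincomb)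
      next
        case 2
        then have "f u d \<in> S" "f u d \<in> S" using all p by auto
        moreover have "?e q = 1 * f u d q + 0 * f u d q" for q
          using p 2 by (cases q) (auto simp: f_def x_def)
        ultimately show ?thesis unfolding S_def by (rule family_span_lincomb)
      next
        case 3
        then have "f u d \<in> S" "f u k \<in> S" using all p by auto
        moreover have "?e q = 1 * f u d q + (-1) * f u k q" for q
          using p 3 by (cases q) (auto simp: f_def x_def)
        ultimately show ?thesis unfolding S_def by (rule family_span_lincomb)
      qed
    qed
    then show "?e \<in> family_span ?g (B <+> motion_index d)" by (simp add: S_def)
  qed
  then have "d * card W \<le> card B + card (motion_index d)"
    using finB finite_motion_index by (simp add: card_Plus card_cartesian_product mult.commute)
  with B show ?thesis by (intro that)
qed

text \<open>Union bound by counting: among all labellings, the share that gives no vertex of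
  \<open>C u v\<close> the label \<open>j\<close> is d/(d+1) to the power
  \<open>card (C u v)\<close>, and by \<open>small\<close> these shares add up to less than
  1.\<close>

lemma labelling_exists:
  fixes C :: "'v \<Rightarrow> 'v \<Rightarrow> 'v set" and s :: nat
  assumes "finite W" and sub: "\<And>u v. u \<in> W \<Longrightarrow> v \<in> W \<Longrightarrow> C u v \<subseteq> W"
    and card: "\<And>u v. u \<in> W \<Longrightarrow> v \<in> W \<Longrightarrow> s \<le> card (C u v)"
    and small: "real (card W) ^ 2 * real (d + 1) * (real d / real (d + 1)) ^ s < 1"
  obtains lab where "\<And>u. u \<in> W \<Longrightarrow> lab u \<le> d"
    "\<And>u v j. u \<in> W \<Longrightarrow> v \<in> W \<Longrightarrow> j \<le> d \<Longrightarrow> \<exists>z\<in>C u v. lab z = j"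
proof -
  let ?F = "PiE W (\<lambda>_. {..d})"
  define bad where "bad = (\<lambda>(u, v, j). PiE W (\<lambda>z. if z \<in> C u v then {..d} - {j} else {..d}))"
  have card_F: "card ?F = (d + 1) ^ card W" using assms(1) by (simp add: card_PiE)
  have card_bad: "real (card (bad (u, v, j))) \<le> real (card ?F) * (real d / real (d + 1)) ^ s"
    if "u \<in> W" "v \<in> W" "j \<le> d" for u v j
  proof -
    have "card (bad (u, v, j)) = (\<Prod>z\<in>W. if z \<in> C u v then d else d + 1)"
      using assms(1) that by (simp add: bad_def card_PiE if_distrib cong: if_cong)
    then have "real (card (bad (u, v, j))) = (\<Prod>z\<in>W. real (d + 1) * (if z \<in> C u v then real d / real (d + 1) else 1))"
      by (simp add: of_nat_prod) (intro prod.cong, auto)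
    also have "\<dots> = real (card ?F) * (\<Prod>z\<in>W. if z \<in> C u v then real d / real (d + 1) else 1)"
      by (simp add: prod.distrib card_F)
    also have "(\<Prod>z\<in>W. if z \<in> C u v then real d / real (d + 1) else 1) = (real d / real (d + 1)) ^ card (C u v)"
      using assms(1) sub[OF that(1,2)] by (simp add: prod.If_cases Int_absorb1)
    also have "real (card ?F) * \<dots> \<le> real (card ?F) * (real d / real (d + 1)) ^ s"
      by (intro mult_left_mono power_decreasing card that) (auto simp: field_simps)
    finally show ?thesis .
  qed
  let ?I = "W \<times> W \<times> {..d}"
  have finI: "finite ?I" using assms(1) by simp
  have "real (card (\<Union>p\<in>?I. bad p)) \<le> (\<Sum>p\<in>?I. real (card (bad p)))"
    using card_UN_le[OF finI, of bad] by (simp flip: of_nat_sum)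
  also have "\<dots> \<le> (\<Sum>p\<in>?I. real (card ?F) * (real d / real (d + 1)) ^ s)"
    using card_bad by (intro sum_mono) auto
  also have "\<dots> = real (card ?F) * (real (card W) ^ 2 * real (d + 1) * (real d / real (d + 1)) ^ s)"
    by (simp add: card_cartesian_product power2_eq_square algebra_simps)
  also have "\<dots> < real (card ?F) * 1"
    using small by (intro mult_strict_left_mono) (auto simp: card_F)
  finally have lt: "card (\<Union>p\<in>?I. bad p) < card ?F" by simp
  have "\<not> ?F \<subseteq> (\<Union>p\<in>?I. bad p)"
  proof
    assume "?F \<subseteq> (\<Union>p\<in>?I. bad p)"
    moreover have "finite (\<Union>p\<in>?I. bad p)"
      using finI assms(1) by (auto simp: bad_def intro!: finite_PiE)
    ultimately show False using lt card_mono by (metis not_le)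
  qed
  then obtain lab where lab: "lab \<in> ?F" "lab \<notin> (\<Union>p\<in>?I. bad p)" by blast
  show ?thesis
  proof (rule that[of lab])
    show "lab u \<le> d" if "u \<in> W" for u using lab(1) that by auto
    fix u v j assume uvj: "u \<in> W" "v \<in> W" "j \<le> d"
    then have "lab \<notin> bad (u, v, j)" using lab(2) by blast
    then show "\<exists>z\<in>C u v. lab z = j"
      using lab(1) by (auto simp: bad_def PiE_iff split: if_splits)
  qed
qed

text \<open>The rows of \<open>B\<close> vanish at \<open>v\<close>, so it suffices that the
  \<open>d\<close> new rows have independent blocks at \<open>v\<close> in some placement
  \<open>z\<close> where \<open>B\<close> is independent too; \<open>generic\<close> transfers the
  result to \<open>x\<close>.\<close>

lemma zero_extension:
  assumes "finite V" "W \<subseteq> V" "v \<in> V - W" "N \<subseteq> W" "card N = d"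
    and generic: "\<And>B y. B \<subseteq> all_pairs V \<Longrightarrow> indep_family (rigidity_row d y) B \<Longrightarrow>
      indep_family (rigidity_row d x) B"
    and B: "B \<subseteq> all_pairs W" "indep_family (rigidity_row d x) B"
  shows "indep_family (rigidity_row d x) (B \<union> (\<lambda>w. {v, w}) ` N)"
    and "card (B \<union> (\<lambda>w. {v, w}) ` N) = card B + d"
proof -
  let ?D = "(\<lambda>w. {v, w}) ` N"
  have finW: "finite W" using assms finite_subset by blast
  have finN: "finite N" using assms finW finite_subset by blast
  have finB: "finite B" using B finW finite_all_pairs finite_subset by blast
  have inj: "inj_on (\<lambda>w. {v, w}) N" by (auto simp: inj_on_def doubleton_eq_iff)
  have vB: "v \<notin> e" if "e \<in> B" for e using that B(1) assms(3) by (auto simp: all_pairs_def)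
  then have disj: "B \<inter> ?D = {}" by blast
  show "card (B \<union> ?D) = card B + d"
    using finB finN disj assms(5) by (simp add: card_Un_disjoint card_image[OF inj])
  obtain h where h: "bij_betw h {..<d} N"
    using ex_bij_betw_nat_finite[OF finN] assms(5) by (auto simp: atLeast0LessThan)
  \<comment> \<open>In \<open>y\<close> the vertex \<open>v\<close> is at the origin and its
    neighbours in \<open>N\<close> at the negative unit vectors, so the blocks at \<open>v\<close>
    are the unit vectors.\<close>
  define y where "y = (\<lambda>w i. if i < d \<and> w = h i then -1 else (0::real))"
  define \<phi> where "\<phi> = (\<lambda>z w i. if i < d then z v i - z w i else (0::real))"
  have yv: "y v i = 0" for i
    using h assms(3,4) by (auto simp: y_def bij_betw_def)
  have "finite {t. \<not> indep_family (rigidity_row d (on_line x y t)) B}"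
    using finW B by (intro finite_dependent_on_line[where s = 0]) auto
  moreover have "finite {t. \<not> indep_family (\<phi> (on_line x y t)) N}"
  proof (rule finite_dependent_pencil[where D = "{..<d}" and s = 1])
    show "indep_family (\<phi> (on_line x y 1)) N"
      unfolding on_line_1 indep_family_def
    proof (intro allI impI ballI)
      fix c w assume c: "\<forall>i. (\<Sum>w\<in>N. c w * \<phi> y w i) = 0" and w: "w \<in> N"
      obtain l where l: "l < d" "w = h l" using h w by (auto simp: bij_betw_def)
      have "(\<Sum>u\<in>N. c u * \<phi> y u l) = (\<Sum>u\<in>N. if u = w then c u else 0)"
      proof (intro sum.cong refl)
        show "c u * \<phi> y u l = (if u = w then c u else 0)" for u
          unfolding \<phi>_def yv using l by (simp add: y_def)
      qed
      also have "\<dots> = c w" using w finN by simp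
      finally show "c w = 0" using c by simp
    qed
    show "\<phi> (on_line x y t) w i = \<phi> x w i + t * (\<phi> y w i - \<phi> x w i)" for t w i
      by (simp add: \<phi>_def on_line_def algebra_simps)
  qed (use finN in \<open>auto simp: \<phi>_def\<close>)
  ultimately have "finite ({t. \<not> indep_family (rigidity_row d (on_line x y t)) B} \<union>
      {t. \<not> indep_family (\<phi> (on_line x y t)) N})"
    by blast
  then obtain t where "t \<notin> {t. \<not> indep_family (rigidity_row d (on_line x y t)) B} \<union>
      {t. \<not> indep_family (\<phi> (on_line x y t)) N}"
    using infinite_UNIV_char_0 ex_new_if_finite by blast
  then obtain z where zB: "indep_family (rigidity_row d z) B" and zN: "indep_family (\<phi> z) N" by blast
  have "indep_family (rigidity_row d z) (B \<union> ?D)"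
    unfolding indep_family_def
  proof (intro allI impI)
    fix c assume c: "\<forall>k. (\<Sum>e\<in>B \<union> ?D. c e * rigidity_row d z e k) = 0"
    have split: "(\<Sum>e\<in>B. c e * rigidity_row d z e k) + (\<Sum>w\<in>N. c {v, w} * rigidity_row d z {v, w} k) = 0" for k
      using c[rule_format, of k] finB finN disj
      by (subst (asm) sum.union_disjoint) (auto simp: sum.reindex[OF inj])
    have "(\<Sum>w\<in>N. c {v, w} * \<phi> z w i) = 0" for i
    proof -
      have "(\<Sum>e\<in>B. c e * rigidity_row d z e (v, i)) = 0"
        using vB by (intro sum.neutral) (auto simp: rigidity_row_def)
      moreover have "(\<Sum>w\<in>N. c {v, w} * rigidity_row d z {v, w} (v, i)) = (\<Sum>w\<in>N. c {v, w} * \<phi> z w i)"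
        using assms(3,4) by (intro sum.cong refl) (subst rigidity_row_pair, auto simp: \<phi>_def)
      ultimately show ?thesis using split[of "(v, i)"] by simp
    qed
    then have N0: "c {v, w} = 0" if "w \<in> N" for w
      using indep_familyD[OF zN, of "\<lambda>w. c {v, w}"] that by blast
    then have "(\<Sum>e\<in>B. c e * rigidity_row d z e k) = 0" for k
      using split[of k] by simp
    then have "c e = 0" if "e \<in> B" for e
      using indep_familyD[OF zB, of c] that by blast
    then show "\<forall>e\<in>B \<union> ?D. c e = 0" using N0 by blast
  qed
  moreover have "B \<union> ?D \<subseteq> all_pairs V"
    using B(1) all_pairs_mono[OF assms(2)] assms(2-4) by (fastforce simp: pair_in_all_pairs)
  ultimately show "indep_family (rigidity_row d x) (B \<union> ?D)"
    by (intro generic)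
qed

subsection \<open>Large rigid subgraphs\<close>

text \<open>In matroid terms, the closure of the edge set of \<open>G[U]\<close> among the pairs of
  \<open>U\<close>.\<close>

definition row_flat :: "nat \<Rightarrow> ('v \<Rightarrow> nat \<Rightarrow> real) \<Rightarrow> 'v set set \<Rightarrow> 'v set \<Rightarrow> 'v set set" where
  "row_flat d x E U =
     {e \<in> all_pairs U. rigidity_row d x e \<in> family_span (rigidity_row d x) (induced_edges E U)}"

text \<open>Full rank d |W| - d(d+1)/2, written without subtraction. \<open>H\<close> will be a
  flat, so the rank may come from pairs that are not edges.\<close>

definition spanned :: "nat \<Rightarrow> ('v \<Rightarrow> nat \<Rightarrow> real) \<Rightarrow> 'v set set \<Rightarrow> 'v set \<Rightarrow> bool" where
  "spanned d x H W \<longleftrightarrow> (\<exists>B\<subseteq>H \<inter> all_pairs W. indep_family (rigidity_row d x) B \<and>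
     d * card W \<le> card B + card (motion_index d))"

definition nbrs :: "'v set set \<Rightarrow> 'v \<Rightarrow> 'v set \<Rightarrow> 'v set" where
  "nbrs E v W = {w \<in> W. {v, w} \<in> E}"

lemma induced_edges_all_pairs: "E \<subseteq> all_pairs V \<Longrightarrow> induced_edges E U \<subseteq> all_pairs U"
  by (auto simp: induced_edges_def all_pairs_def)

lemma induced_edges_row_flat:
  assumes "finite U" "E \<subseteq> all_pairs V"
  shows "induced_edges E U \<subseteq> row_flat d x E U"
proof -
  have "finite (induced_edges E U)"
    using assms finite_all_pairs finite_subset induced_edges_all_pairs by metis
  then show ?thesis
    using induced_edges_all_pairs[OF assms(2), of U] by (auto simp: row_flat_def family_span_base)
qed

lemma card_pair_incidences:
  assumes "finite U" "M \<subseteq> all_pairs U"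
  shows "(\<Sum>u\<in>U. card (nbrs M u U)) = 2 * card M"
proof -
  have finM: "finite M" using assms finite_all_pairs finite_subset by blast
  have "(\<Sum>u\<in>U. card (nbrs M u U)) = (\<Sum>u\<in>U. card {e \<in> M. u \<in> e})"
  proof (intro sum.cong refl)
    fix u assume u: "u \<in> U"
    have "bij_betw (\<lambda>w. {u, w}) (nbrs M u U) {e \<in> M. u \<in> e}"
    proof (rule bij_betw_imageI)
      show "inj_on (\<lambda>w. {u, w}) (nbrs M u U)" by (auto simp: inj_on_def doubleton_eq_iff)
      show "(\<lambda>w. {u, w}) ` nbrs M u U = {e \<in> M. u \<in> e}"
      proof (intro equalityI subsetI)
        fix e assume "e \<in> {e \<in> M. u \<in> e}"
        then have e: "e \<in> M" "u \<in> e" by auto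
        then obtain a b where "e = {a, b}" "a \<in> U" "b \<in> U"
          using assms(2) by (meson in_all_pairsE subsetD)
        then show "e \<in> (\<lambda>w. {u, w}) ` nbrs M u U"
          using e by (auto simp: nbrs_def insert_commute)
      qed (auto simp: nbrs_def)
    qed
    then show "card (nbrs M u U) = card {e \<in> M. u \<in> e}" by (rule bij_betw_same_card)
  qed
  also have "\<dots> = (\<Sum>u\<in>U. \<Sum>e\<in>M. if u \<in> e then 1 else 0)"
    using finM by (simp add: sum.If_cases Int_def)
  also have "\<dots> = (\<Sum>e\<in>M. \<Sum>u\<in>U. if u \<in> e then 1 else 0)" by (rule sum.swap)
  also have "\<dots> = (\<Sum>e\<in>M. 2)"
  proof (intro sum.cong refl)
    fix e assume "e \<in> M"
    then have "U \<inter> e = e" "card e = 2" using assms(2) by (auto simp: all_pairs_def)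
    then show "(\<Sum>u\<in>U. if u \<in> e then 1 else 0) = (2::nat)"
      using assms(1) by (simp add: sum.If_cases Int_def)
  qed
  finally show ?thesis by simp
qed

section \<open>Rank of flats and the choice of the vertex set\<close>

locale generic_placement =
  fixes V :: "'v set" and d :: nat and x :: "'v \<Rightarrow> nat \<Rightarrow> real"
  assumes finite_V: "finite V"
    and generic: "\<And>B y. B \<subseteq> all_pairs V \<Longrightarrow> indep_family (rigidity_row d y) B \<Longrightarrow>
      indep_family (rigidity_row d x) B"
begin

lemma spanned_insert:
  assumes "E \<subseteq> all_pairs V" "W \<subseteq> U" "U \<subseteq> V" "v \<in> U - W" "d \<le> card (nbrs E v W)"
    and "spanned d x (row_flat d x E U) W"
  shows "spanned d x (row_flat d x E U) (insert v W)"
proof -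
  have fin: "finite U" "finite W" using assms(2,3) finite_V by (meson finite_subset)+
  obtain B where B: "B \<subseteq> row_flat d x E U \<inter> all_pairs W" "indep_family (rigidity_row d x) B"
      "d * card W \<le> card B + card (motion_index d)"
    using assms(6) unfolding spanned_def by blast
  obtain N where N: "N \<subseteq> nbrs E v W" "card N = d"
    using assms(5) obtain_subset_with_card_n by metis
  let ?B = "B \<union> (\<lambda>w. {v, w}) ` N"
  have "N \<subseteq> W" "W \<subseteq> V" "v \<in> V - W" using N(1) assms(2-4) by (auto simp: nbrs_def)
  note ext = zero_extension[OF finite_V \<open>W \<subseteq> V\<close> \<open>v \<in> V - W\<close> \<open>N \<subseteq> W\<close> N(2) generic _ B(2)]
  have "indep_family (rigidity_row d x) ?B" "card ?B = card B + d" using ext B(1) by auto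
  moreover have "?B \<subseteq> row_flat d x E U \<inter> all_pairs (insert v W)"
  proof -
    have "(\<lambda>w. {v, w}) ` N \<subseteq> induced_edges E U"
      using N(1) assms(2,4) by (auto simp: nbrs_def induced_edges_def)
    moreover have "(\<lambda>w. {v, w}) ` N \<subseteq> all_pairs (insert v W)"
      using \<open>N \<subseteq> W\<close> assms(4) by (auto simp: pair_in_all_pairs)
    ultimately show ?thesis
      using B(1) induced_edges_row_flat[OF fin(1) assms(1)] all_pairs_mono[of W "insert v W"] by blast
  qed
  moreover have "d * card (insert v W) = d * card W + d"
    using fin assms(4) by simp
  ultimately show ?thesis
    unfolding spanned_def using B(3) by (intro exI[of _ ?B]) auto
qed

text \<open>The flat does not enlarge the row span, so a basis \<open>C\<close> of the rows of
  \<open>G[U]\<close> is at least as large as the independent set found in the flat.\<close>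

lemma d_rigid_if_spanned:
  assumes "E \<subseteq> all_pairs V" "U \<subseteq> V" "d + 1 \<le> card U" "spanned d x (row_flat d x E U) U"
  shows "d_rigid d U (induced_edges E U)"
proof -
  have fin: "finite U" using assms(2) finite_V by (rule finite_subset)
  have ind: "induced_edges E U \<subseteq> all_pairs U" using induced_edges_all_pairs assms(1) by blast
  then have finE: "finite (induced_edges E U)" using fin finite_all_pairs finite_subset by blast
  obtain B where B: "B \<subseteq> row_flat d x E U" "indep_family (rigidity_row d x) B"
      "d * card U \<le> card B + card (motion_index d)"
    using assms(4) unfolding spanned_def by blast
  have finB: "finite B" using B(1) finite_all_pairs[OF fin] unfolding row_flat_def by (auto intro: finite_subset)
  obtain C where C: "C \<subseteq> induced_edges E U" "indep_family (rigidity_row d x) C"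
      "\<And>e. e \<in> induced_edges E U \<Longrightarrow> rigidity_row d x e \<in> family_span (rigidity_row d x) C"
    using family_basis_exists[OF finE] by blast
  have finC: "finite C" using C(1) finE finite_subset by blast
  have "card B \<le> card C"
  proof (rule card_indep_family_le[OF finB finC B(2)])
    fix e assume "e \<in> B"
    then have "rigidity_row d x e \<in> family_span (rigidity_row d x) (induced_edges E U)"
      using B(1) by (auto simp: row_flat_def)
    with finE C(3) show "rigidity_row d x e \<in> family_span (rigidity_row d x) C"
      by (rule family_span_trans)
  qed
  then show ?thesis
    using B(3) by (intro d_rigid_if_independent_rows[OF fin assms(3) ind C(1,2)]) simp
qed

text \<open>Vertices in at least 0.3 n missing pairs are discarded. By double counting there are at
  most (0.08 / 0.3) n of them, which leaves more than 0.723 n. Two remaining vertices share more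
  than 0.723 n - 0.6 n - 2 neighbours, at least 0.12 n once n >= 1000, which is enough for the
  labelling.\<close>

lemma spanned_if_few_missing_pairs:
  assumes "H \<subseteq> all_pairs U" "U \<subseteq> V" "1000 \<le> card V"
    and missing: "real (card (all_pairs U - H)) \<le> 0.04 * real (card V) ^ 2"
    and U: "0.99 * real (card V) \<le> real (card U)"
    and s: "real s \<le> 0.12 * real (card V)"
    and small: "real (card V) ^ 2 * real (d + 1) * (real d / real (d + 1)) ^ s < 1"
  obtains W where "W \<subseteq> U" "0.72 * real (card V) \<le> real (card W)" "spanned d x H W"
proof -
  define n where "n = real (card V)"
  have n: "n \<ge> 1000" using assms(3) by (simp add: n_def)
  have finU: "finite U" using assms(2) finite_V by (rule finite_subset)
  let ?M = "all_pairs U - H"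
  define bad where "bad = {u \<in> U. 0.3 * n \<le> real (card (nbrs ?M u U))}"
  have "0.3 * n * real (card bad) \<le> (\<Sum>u\<in>bad. real (card (nbrs ?M u U)))"
    using sum_bounded_below[of bad "0.3 * n" "\<lambda>u. real (card (nbrs ?M u U))"]
    by (simp add: bad_def mult.commute)
  also have "\<dots> \<le> (\<Sum>u\<in>U. real (card (nbrs ?M u U)))"
    using finU by (intro sum_mono2) (auto simp: bad_def)
  also have "\<dots> = 2 * real (card ?M)"
    using card_pair_incidences[OF finU, of ?M] by (simp flip: of_nat_sum)
  also have "\<dots> \<le> 0.08 * n * n"
    using missing by (simp add: n_def power2_eq_square)
  finally have "n * (0.3 * real (card bad)) \<le> n * (0.08 * n)" by (simp add: mult_ac)
  then have bad: "0.3 * real (card bad) \<le> 0.08 * n" using n by (simp add: mult_le_cancel_left)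
  define W where "W = U - bad"
  have W: "W \<subseteq> U" and finW: "finite W" using finU by (auto simp: W_def)
  have cardW: "real (card W) = real (card U) - real (card bad)"
    using finU by (simp add: W_def bad_def card_Diff_subset of_nat_diff card_mono)
  have WV: "card W \<le> card V" using W assms(2) finite_V by (meson card_mono subset_trans)
  define C where "C = (\<lambda>u v. {z \<in> W. {u, z} \<in> H \<inter> all_pairs W \<and> {v, z} \<in> H \<inter> all_pairs W})"
  have "s \<le> card (C u v)" if "u \<in> W" "v \<in> W" for u v
  proof -
    have "W \<subseteq> C u v \<union> {u, v} \<union> nbrs ?M u U \<union> nbrs ?M v U"
      using W that by (auto simp: C_def nbrs_def pair_in_all_pairs)
    moreover have fin: "finite (C u v)" "finite (nbrs ?M u U)" "finite (nbrs ?M v U)"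
      using finU finW by (auto simp: C_def nbrs_def)
    ultimately have "card W \<le> card (C u v \<union> {u, v} \<union> nbrs ?M u U \<union> nbrs ?M v U)"
      by (intro card_mono) auto
    also have "\<dots> \<le> card (C u v) + card {u, v} + card (nbrs ?M u U) + card (nbrs ?M v U)"
      by (meson add_le_mono1 card_Un_le le_trans)
    finally have "card W \<le> card (C u v) + 2 + card (nbrs ?M u U) + card (nbrs ?M v U)"
      using card_insert_le_m1[of 2 "{v}" u] by (simp add: card_insert_if split: if_splits)
    then have "real (card W) \<le> real (card (C u v) + 2 + card (nbrs ?M u U) + card (nbrs ?M v U))"
      by (rule of_nat_mono)
    then have "real (card W) \<le> real (card (C u v)) + 2 + real (card (nbrs ?M u U)) + real (card (nbrs ?M v U))"
      by (simp only: of_nat_add of_nat_numeral)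
    moreover have "real (card (nbrs ?M u U)) \<le> 0.3 * n" "real (card (nbrs ?M v U)) \<le> 0.3 * n"
      using that by (auto simp: W_def bad_def)
    ultimately have "real s \<le> real (card (C u v))"
      using cardW bad U s n by (simp add: n_def)
    then show ?thesis by simp
  qed
  moreover have "real (card W) ^ 2 * real (d + 1) * (real d / real (d + 1)) ^ s < 1"
  proof -
    have "real (card W) ^ 2 * real (d + 1) * (real d / real (d + 1)) ^ s
        \<le> real (card V) ^ 2 * real (d + 1) * (real d / real (d + 1)) ^ s"
      using WV by (intro mult_right_mono power_mono) auto
    then show ?thesis using small by linarith
  qed
  ultimately obtain lab where lab: "\<And>u. u \<in> W \<Longrightarrow> lab u \<le> d"
      "\<And>u v j. u \<in> W \<Longrightarrow> v \<in> W \<Longrightarrow> j \<le> d \<Longrightarrow> \<exists>z\<in>C u v. lab z = j"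
    using labelling_exists[OF finW, of C s d] by (metis (no_types, lifting) C_def mem_Collect_eq subsetI)
  have large: "0.72 * n \<le> real (card W)" using cardW bad U n by (simp add: n_def)
  have common: "\<And>u v j. u \<in> W \<Longrightarrow> v \<in> W \<Longrightarrow> j \<le> d \<Longrightarrow>
      \<exists>z\<in>W. lab z = j \<and> {u, z} \<in> H \<inter> all_pairs W \<and> {v, z} \<in> H \<inter> all_pairs W"
    using lab(2) unfolding C_def by blast
  have "W \<noteq> {}" using large n by auto
  obtain y B where B: "B \<subseteq> H \<inter> all_pairs W" "indep_family (rigidity_row d y) B"
      "d * card W \<le> card B + card (motion_index d)"
    by (rule independent_rows_if_labelled[OF finW \<open>W \<noteq> {}\<close> Int_lower2 common lab(1)])
  have "W \<subseteq> V" using W assms(2) by (rule subset_trans)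
  then have "B \<subseteq> all_pairs V" using B(1) by (auto simp: all_pairs_def)
  then have "indep_family (rigidity_row d x) B" using B(2) by (rule generic)
  then have "spanned d x H W" unfolding spanned_def using B(1,3) by (intro exI[of _ B] conjI)
  with W large show ?thesis unfolding n_def by (rule that)
qed

text \<open>Vertices outside \<open>U\<close> send fewer than \<open>d\<close> edges into
  \<open>W\<close> by the choice of \<open>U\<close>, and those of \<open>U - W\<close> by
  maximality of \<open>W\<close>. So the complement of \<open>W\<close>, of size at most 0.28 n,
  contradicts \<open>expand\<close> unless it has at most \<open>\<eta>\<close> n vertices. Then
  \<open>W\<close> satisfies the conditions on \<open>U\<close>, and minimality gives
  \<open>W = U\<close>.\<close>

theorem large_d_rigid_subgraph:
  fixes \<eta> :: real
  assumes E: "E \<subseteq> all_pairs V" and n: "1000 \<le> card V" and \<eta>: "0 \<le> \<eta>" "\<eta> \<le> 0.01"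
    and d: "real d + 1 \<le> 0.7 * real (card V)"
    and s: "real s \<le> 0.12 * real (card V)"
    and small: "real (card V) ^ 2 * real (d + 1) * (real d / real (d + 1)) ^ s < 1"
    and missing: "\<And>U. U \<subseteq> V \<Longrightarrow> real (card (all_pairs U - row_flat d x E U)) \<le> 0.04 * real (card V) ^ 2"
    and expand: "\<And>X. X \<subseteq> V \<Longrightarrow> \<eta> * real (card V) < real (card X) \<Longrightarrow> real (card X) \<le> 0.3 * real (card V) \<Longrightarrow>
      \<exists>v\<in>X. d \<le> card (nbrs E v (V - X))"
  shows "\<exists>U\<subseteq>V. (1 - \<eta>) * real (card V) \<le> real (card U) \<and> d_rigid d U (induced_edges E U)"
proof -
  let ?P = "\<lambda>U. U \<subseteq> V \<and> (1 - \<eta>) * real (card V) \<le> real (card U) \<and> (\<forall>v\<in>V - U. card (nbrs E v U) < d)"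
  have "?P V" using \<eta> by (simp add: mult_left_le_one_le)
  from ex_has_least_nat[where P = ?P and m = card, OF this]
  obtain U where U: "?P U" "\<And>U'. ?P U' \<Longrightarrow> card U \<le> card U'" by (elim exE conjE) simp
  have finU: "finite U" using U(1) finite_V by (meson finite_subset)
  let ?H = "row_flat d x E U"
  let ?Q = "\<lambda>W. W \<subseteq> U \<and> 0.72 * real (card V) \<le> real (card W) \<and> spanned d x ?H W"
  have U99: "0.99 * real (card V) \<le> real (card U)"
  proof -
    have "0.99 * real (card V) \<le> (1 - \<eta>) * real (card V)"
      using \<eta> by (intro mult_right_mono) auto
    then show ?thesis using U(1) by linarith
  qed
  obtain W0 where W0: "?Q W0"
  proof (rule spanned_if_few_missing_pairs[OF _ _ n _ U99 s small, of ?H])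
    show "?H \<subseteq> all_pairs U" by (auto simp: row_flat_def)
    show "U \<subseteq> V" using U(1) by simp
    then show "real (card (all_pairs U - ?H)) \<le> 0.04 * real (card V) ^ 2" by (rule missing)
  qed simp
  have "\<forall>W. ?Q W \<longrightarrow> card W < Suc (card U)"
    using card_mono[OF finU] by (simp add: less_Suc_eq_le)
  from ex_has_greatest_nat[where P = ?Q and f = card, OF W0 this]
  obtain W where W: "?Q W" "\<And>W'. ?Q W' \<Longrightarrow> card W' \<le> card W" by (elim exE conjE) simp
  have finW: "finite W" using W(1) finU by (meson finite_subset)
  have "W = U"
  proof (rule ccontr)
    assume "W \<noteq> U"
    then have "W \<subset> U" using W(1) by (simp add: psubset_eq)
    then have less: "card W < card U" using finU psubset_card_mono by blast
    have few: "card (nbrs E v W) < d" if v: "v \<in> V - W" for v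
    proof (cases "v \<in> U")
      case False
      have "card (nbrs E v W) \<le> card (nbrs E v U)"
        using W(1) finU by (intro card_mono) (auto simp: nbrs_def)
      moreover have "card (nbrs E v U) < d" using U(1) False v by simp
      ultimately show ?thesis by simp
    next
      case True
      show ?thesis
      proof (rule ccontr)
        assume "\<not> card (nbrs E v W) < d"
        then have "spanned d x ?H (insert v W)"
          using spanned_insert[of E W U v] E W(1) U(1) v True by simp
        then have "?Q (insert v W)"
          using W(1) True v finW by auto
        then have "card (insert v W) \<le> card W" by (rule W(2))
        then show False using v finW by simp
      qed
    qed
    define X where "X = V - W"
    have WV: "W \<subseteq> V" using W(1) U(1) by (meson subset_trans)
    then have cardX: "real (card X) = real (card V) - real (card W)"
      using finite_V by (simp add: X_def card_Diff_subset finW of_nat_diff card_mono)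
    have VX: "V - X = W" using WV by (auto simp: X_def)
    have "\<not> \<eta> * real (card V) < real (card X)"
    proof
      assume "\<eta> * real (card V) < real (card X)"
      moreover have "real (card X) \<le> 0.3 * real (card V)" using cardX W(1) by simp
      ultimately obtain v where "v \<in> X" "d \<le> card (nbrs E v W)"
        using expand[of X] VX by (auto simp: X_def)
      then show False using few[of v] by (simp add: X_def)
    qed
    then have "?P W" using few WV cardX by (simp add: algebra_simps)
    then have "card U \<le> card W" by (rule U(2))
    then show False using less by simp
  qed
  then have "spanned d x ?H U" using W(1) by simp
  moreover have "d + 1 \<le> card U"
  proof -
    have "0.7 * real (card V) \<le> 0.99 * real (card V)" by simp
    then have "real d + 1 \<le> real (card U)" using d U99 by linarith
    then show ?thesis by linarith
  qed
  ultimately have "d_rigid d U (induced_edges E U)"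
    using U(1) by (intro d_rigid_if_spanned[OF E]) simp_all
  then show ?thesis using U(1) by (intro exI[of _ U]) simp
qed

end

subsection \<open>Sparse flats and sparse cuts of the random graph\<close>

lemma vertex_pairs_eq: "vertex_pairs n = all_pairs {1..n}"
  by (simp add: vertex_pairs_def all_pairs_def)

lemma set_pmf_random_graph: "E \<in> set_pmf (random_graph n p) \<Longrightarrow> E \<subseteq> vertex_pairs n"
  by (auto simp: random_graph_def)

lemma prob_random_graph_contains_avoids:
  assumes "0 \<le> p" "p \<le> 1" "B \<subseteq> vertex_pairs n" "C \<subseteq> vertex_pairs n" "B \<inter> C = {}"
  shows "measure_pmf.prob (random_graph n p) {E. B \<subseteq> E \<and> E \<inter> C = {}} = p ^ card B * (1 - p) ^ card C"
proof -
  let ?V = "vertex_pairs n"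
  have fin: "finite ?V" by (simp add: vertex_pairs_eq finite_all_pairs)
  let ?S = "\<lambda>e. if e \<in> B then {True} else if e \<in> C then {False} else UNIV"
  have "(\<lambda>f. {e \<in> ?V. f e}) -` {E. B \<subseteq> E \<and> E \<inter> C = {}} = Pi ?V ?S"
  proof (rule Set.set_eqI)
    fix f
    have "f \<in> Pi ?V ?S \<longleftrightarrow> (\<forall>e\<in>B. f e) \<and> (\<forall>e\<in>C. \<not> f e)"
      unfolding Pi_iff using assms(3-5) by (force split: if_splits)
    moreover have "B \<subseteq> {e \<in> ?V. f e} \<and> {e \<in> ?V. f e} \<inter> C = {} \<longleftrightarrow> (\<forall>e\<in>B. f e) \<and> (\<forall>e\<in>C. \<not> f e)"
      using assms(3,4) by auto
    ultimately show "f \<in> (\<lambda>f. {e \<in> ?V. f e}) -` {E. B \<subseteq> E \<and> E \<inter> C = {}} \<longleftrightarrow> f \<in> Pi ?V ?S"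
      by (simp only: vimage_eq mem_Collect_eq)
  qed
  then have "measure_pmf.prob (random_graph n p) {E. B \<subseteq> E \<and> E \<inter> C = {}} =
      measure_pmf.prob (Pi_pmf ?V False (\<lambda>_. bernoulli_pmf p)) (Pi ?V ?S)"
    by (simp add: random_graph_def)
  also have "\<dots> = (\<Prod>e\<in>?V. measure_pmf.prob (bernoulli_pmf p) (?S e))"
    by (rule measure_Pi_pmf_Pi[OF fin])
  also have "\<dots> = (\<Prod>e\<in>?V. (if e \<in> B then p else 1) * (if e \<in> C then 1 - p else 1))"
    using assms by (intro prod.cong refl) (auto simp: measure_pmf_single)
  also have "\<dots> = p ^ card B * (1 - p) ^ card C"
    using fin assms(3,4) by (simp add: prod.distrib prod.If_cases Int_absorb1)
  finally show ?thesis .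
qed

lemma sum_Pow_weights:
  fixes a b :: real
  assumes "finite A"
  shows "(\<Sum>B\<in>Pow A. a ^ card B * b ^ card (A - B)) = (a + b) ^ card A"
  using prod_add[OF assms, of "\<lambda>_. a" "\<lambda>_. b"] by simp

text \<open>Chernoff bound: \<open>s ^ k\<close> dominates \<open>s ^ card B\<close>, and with this
  extra weight the truncated sum extends to a full binomial expansion. The case \<open>b = 1\<close>
  counts candidate bases; \<open>b = 1 - p\<close> bounds a lower tail.\<close>

lemma sum_small_subsets_le:
  fixes a b s :: real
  assumes "finite A" "0 \<le> a" "0 \<le> b" "1 \<le> s"
  shows "(\<Sum>B | B \<subseteq> A \<and> card B \<le> k. a ^ card B * b ^ card (A - B)) \<le> s ^ k * (a / s + b) ^ card A"
proof -
  have "(\<Sum>B | B \<subseteq> A \<and> card B \<le> k. a ^ card B * b ^ card (A - B)) \<le>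
      (\<Sum>B | B \<subseteq> A \<and> card B \<le> k. s ^ k * ((a / s) ^ card B * b ^ card (A - B)))"
  proof (rule sum_mono)
    fix B assume "B \<in> {B. B \<subseteq> A \<and> card B \<le> k}"
    then have "s ^ card B \<le> s ^ k" using assms by (intro power_increasing) auto
    then have "s ^ card B * ((a / s) ^ card B * b ^ card (A - B)) \<le> s ^ k * ((a / s) ^ card B * b ^ card (A - B))"
      using assms by (intro mult_right_mono) auto
    moreover have "s ^ card B * (a / s) ^ card B = a ^ card B"
      using assms by (simp flip: power_mult_distrib)
    ultimately show "a ^ card B * b ^ card (A - B) \<le> s ^ k * ((a / s) ^ card B * b ^ card (A - B))"
      by (simp flip: mult.assoc)
  qed
  also have "\<dots> \<le> (\<Sum>B\<in>Pow A. s ^ k * ((a / s) ^ card B * b ^ card (A - B)))"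
    using assms by (intro sum_mono2) auto
  also have "\<dots> = s ^ k * (a / s + b) ^ card A"
    using sum_Pow_weights[OF assms(1), of "a / s" b] by (simp flip: sum_distrib_left)
  finally show ?thesis .
qed

lemma prob_le_sum_if_covered:
  fixes P :: "'a pmf"
  assumes "finite I" "Q \<inter> set_pmf P \<subseteq> (\<Union>i\<in>I. A i)" "\<And>i. i \<in> I \<Longrightarrow> measure_pmf.prob P (A i) \<le> b i"
  shows "measure_pmf.prob P Q \<le> (\<Sum>i\<in>I. b i)"
proof -
  have "measure_pmf.prob P Q = measure_pmf.prob P (Q \<inter> set_pmf P)" by (simp add: measure_Int_set_pmf)
  also have "\<dots> \<le> measure_pmf.prob P (\<Union>i\<in>I. A i)"
    using assms(2) by (intro measure_pmf.finite_measure_mono) auto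
  also have "\<dots> \<le> (\<Sum>i\<in>I. measure_pmf.prob P (A i))"
    using assms(1) by (intro measure_pmf.finite_measure_subadditive_finite) auto
  also have "\<dots> \<le> (\<Sum>i\<in>I. b i)" using assms(3) by (rule sum_mono)
  finally show ?thesis .
qed

lemma power_one_minus_le_exp:
  fixes p :: real
  assumes "p \<le> 1" "m \<le> real k" "0 \<le> p"
  shows "(1 - p) ^ k \<le> exp (- (p * m))"
proof -
  have "(1 - p) ^ k \<le> exp (- p) ^ k"
    using assms exp_ge_add_one_self[of "- p"] by (intro power_mono) auto
  also have "\<dots> = exp (- (p * real k))" by (simp add: exp_of_nat_mult[symmetric] mult.commute)
  also have "\<dots> \<le> exp (- (p * m))" using assms by (simp add: mult_left_mono)
  finally show ?thesis .
qed

lemma card_all_pairs_le: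
  assumes "finite U" "card U \<le> n"
  shows "real (card (all_pairs U)) \<le> real n ^ 2 / 2"
proof -
  have "card (all_pairs U) = card U choose 2"
    unfolding all_pairs_def using n_subsets[OF assms(1)] by simp
  then have "2 * card (all_pairs U) \<le> card U * card U"
    by (simp add: choose_two) (meson diff_le_self dual_order.trans mult_le_mono2 times_div_less_eq_dividend)
  also have "\<dots> \<le> n * n" using assms(2) by (rule mult_le_mono) (rule assms(2))
  finally have "real (2 * card (all_pairs U)) \<le> real (n * n)" by (rule of_nat_mono)
  then show ?thesis by (simp add: power2_eq_square)
qed

text \<open>If the flat spanned by \<open>E\<close> inside \<open>U\<close> misses many pairs, then so does the flat of some basis \<open>B\<close>,
  which has at most \<open>d n\<close> elements. The union bound runs over \<open>U\<close> and \<open>B\<close>.\<close>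

lemma prob_sparse_flat_le:
  fixes p s :: real
  assumes p: "0 \<le> p" "p \<le> 1" and s: "1 \<le> s"
  shows "measure_pmf.prob (random_graph n p)
      {E. \<exists>U\<subseteq>{1..n}. 0.04 * real n ^ 2 < real (card (all_pairs U - row_flat d x E U))} \<le>
    2 ^ n * (s ^ (d * n) * exp (p * real n ^ 2 / (2 * s))) * exp (- (p * (0.04 * real n ^ 2)))"
    (is "measure_pmf.prob _ ?Q \<le> _")
proof -
  let ?r = "rigidity_row d x"
  \<comment> \<open>\<open>miss\<close> depends on \<open>U\<close> and \<open>B\<close> but not on
    \<open>E\<close>, so each event of the union bound prescribes fixed disjoint sets of present and
    absent pairs.\<close>
  define miss where "miss = (\<lambda>U B. {e \<in> all_pairs U. ?r e \<notin> family_span ?r B})"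
  define J where "J = (\<lambda>U :: nat set. {B. B \<subseteq> all_pairs U \<and> card B \<le> d * n})"
  define I where "I = (SIGMA U:Pow {1..n}. {B \<in> J U. 0.04 * real n ^ 2 < real (card (miss U B))})"
  let ?A = "\<lambda>(U, B). {E. B \<subseteq> E \<and> E \<inter> miss U B = {}}"
  have finU: "finite U" if "U \<subseteq> {1..n}" for U using that finite_subset by blast
  have finJ: "finite (J U)" if "U \<subseteq> {1..n}" for U
    unfolding J_def using finite_all_pairs[OF finU[OF that]] by simp
  have finI: "finite I"
    unfolding I_def using finJ by (intro finite_SigmaI) auto
  have cover: "?Q \<inter> set_pmf (random_graph n p) \<subseteq> (\<Union>i\<in>I. ?A i)"
  proof
    fix E assume "E \<in> ?Q \<inter> set_pmf (random_graph n p)"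
    then obtain U where U: "U \<subseteq> {1..n}" "0.04 * real n ^ 2 < real (card (all_pairs U - row_flat d x E U))"
      and E: "E \<subseteq> all_pairs {1..n}"
      using set_pmf_random_graph vertex_pairs_eq by blast
    let ?D = "induced_edges E U"
    have D: "?D \<subseteq> all_pairs U" using induced_edges_all_pairs E by blast
    then have finD: "finite ?D" using finite_all_pairs[OF finU[OF U(1)]] finite_subset by blast
    obtain B where B: "B \<subseteq> ?D" "indep_family ?r B" "\<And>e. e \<in> ?D \<Longrightarrow> ?r e \<in> family_span ?r B"
      by (rule family_basis_exists[OF finD, of ?r]) (rule that)
    have finB: "finite B" using B(1) finD by (rule finite_subset)
    have "card B \<le> card (U \<times> {..<d})"
    proof (rule card_indep_family_le_support[OF _ finB B(2)])
      show "finite (U \<times> {..<d})" using finU[OF U(1)] by simp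
      show "?r e k = 0" if "e \<in> B" "k \<notin> U \<times> {..<d}" for e k
        using that B(1) D by (intro rigidity_row_outside) auto
    qed
    also have "\<dots> \<le> d * n"
      using card_mono[OF _ U(1)] by (simp add: card_cartesian_product mult.commute)
    finally have "B \<in> J U" using B(1) D by (simp add: J_def)
    moreover have "0.04 * real n ^ 2 < real (card (miss U B))"
    proof -
      have "all_pairs U - row_flat d x E U \<subseteq> miss U B"
        using family_span_trans[OF finB, of ?r ?r ?D] family_span_base[OF finD, of _ ?r] B(1)
        by (auto simp: row_flat_def miss_def)
      moreover have "finite (miss U B)"
        unfolding miss_def using finite_all_pairs[OF finU[OF U(1)]] by simp
      ultimately have "card (all_pairs U - row_flat d x E U) \<le> card (miss U B)" by (intro card_mono)
      then show ?thesis using U(2) by linarith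
    qed
    moreover have "E \<inter> miss U B = {}"
      using B(3) by (auto simp: miss_def induced_edges_def all_pairs_def)
    moreover have "B \<subseteq> E" using B(1) by (auto simp: induced_edges_def)
    ultimately have "(U, B) \<in> I" "E \<in> ?A (U, B)" using U(1) by (auto simp: I_def)
    then show "E \<in> (\<Union>i\<in>I. ?A i)" by blast
  qed
  let ?e = "exp (- (p * (0.04 * real n ^ 2)))"
  have "measure_pmf.prob (random_graph n p) ?Q \<le> (\<Sum>i\<in>I. case i of (U, B) \<Rightarrow> p ^ card B * ?e)"
  proof (rule prob_le_sum_if_covered[OF finI cover], clarify)
    fix U B assume UB: "(U, B) \<in> I"
    then have U: "U \<subseteq> {1..n}" and B: "B \<subseteq> all_pairs U" and m: "0.04 * real n ^ 2 \<le> real (card (miss U B))"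
      by (auto simp: I_def J_def)
    have sub: "all_pairs U \<subseteq> vertex_pairs n" unfolding vertex_pairs_eq using U by (rule all_pairs_mono)
    have finB: "finite B" using B finite_all_pairs[OF finU[OF U]] by (rule finite_subset)
    have "measure_pmf.prob (random_graph n p) {E. B \<subseteq> E \<and> E \<inter> miss U B = {}} =
        p ^ card B * (1 - p) ^ card (miss U B)"
      using B sub family_span_base[OF finB, of _ ?r]
      by (intro prob_random_graph_contains_avoids[OF p]) (auto simp: miss_def)
    also have "\<dots> \<le> p ^ card B * ?e"
      using p m by (intro mult_left_mono power_one_minus_le_exp) auto
    finally show "measure_pmf.prob (random_graph n p) {E. B \<subseteq> E \<and> E \<inter> miss U B = {}} \<le> p ^ card B * ?e" .
  qed
  also have "\<dots> = (\<Sum>U\<in>Pow {1..n}. \<Sum>B | B \<in> J U \<and> 0.04 * real n ^ 2 < real (card (miss U B)). p ^ card B * ?e)"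
    unfolding I_def using finJ by (subst sum.Sigma) auto
  also have "\<dots> \<le> (\<Sum>U\<in>Pow {1..n}. s ^ (d * n) * exp (p * real n ^ 2 / (2 * s)) * ?e)"
  proof (rule sum_mono)
    fix U assume "U \<in> Pow {1..n}"
    then have U: "U \<subseteq> {1..n}" by blast
    have "(\<Sum>B | B \<in> J U \<and> 0.04 * real n ^ 2 < real (card (miss U B)). p ^ card B * ?e) \<le>
        (\<Sum>B\<in>J U. p ^ card B * ?e)"
      using finJ[OF U] p by (intro sum_mono2) auto
    \<comment> \<open>Pairs outside \<open>B\<close> get weight 1: the absent ones are already
      charged to \<open>?e\<close>, and only the weighted count of candidate bases remains.\<close>
    also have "\<dots> = (\<Sum>B | B \<subseteq> all_pairs U \<and> card B \<le> d * n. p ^ card B * 1 ^ card (all_pairs U - B)) * ?e"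
      by (simp add: J_def sum_distrib_right)
    also have "\<dots> \<le> (s ^ (d * n) * (p / s + 1) ^ card (all_pairs U)) * ?e"
      using finite_all_pairs[OF finU[OF U]] p s by (intro mult_right_mono sum_small_subsets_le) auto
    also have "\<dots> \<le> (s ^ (d * n) * exp (p * real n ^ 2 / (2 * s))) * ?e"
    proof (intro mult_right_mono mult_left_mono)
      have "(p / s + 1) ^ card (all_pairs U) \<le> exp (p / s) ^ card (all_pairs U)"
        using p s exp_ge_add_one_self[of "p / s"] by (intro power_mono) (auto simp: add.commute)
      also have "\<dots> = exp (real (card (all_pairs U)) * (p / s))" by (rule exp_of_nat_mult[symmetric])
      also have "\<dots> \<le> exp (real n ^ 2 / 2 * (p / s))"
        using p s card_all_pairs_le[OF finU[OF U], of n] card_mono[OF _ U]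
        by (simp only: exp_le_cancel_iff) (intro mult_right_mono, auto)
      finally show "(p / s + 1) ^ card (all_pairs U) \<le> exp (p * real n ^ 2 / (2 * s))"
        by (simp add: mult.commute)
    qed (use s in auto)
    finally show "(\<Sum>B | B \<in> J U \<and> 0.04 * real n ^ 2 < real (card (miss U B)). p ^ card B * ?e) \<le>
        s ^ (d * n) * exp (p * real n ^ 2 / (2 * s)) * ?e" .
  qed
  also have "\<dots> = 2 ^ n * (s ^ (d * n) * exp (p * real n ^ 2 / (2 * s))) * ?e"
    by (simp add: card_Pow)
  finally show ?thesis .
qed

section \<open>Sets sending few edges outside\<close>

definition cut :: "'v set \<Rightarrow> 'v set \<Rightarrow> 'v set set" where
  "cut X Y = (\<lambda>(v, w). {v, w}) ` (X \<times> Y)"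

lemma card_cut: "X \<inter> Y = {} \<Longrightarrow> card (cut X Y) = card X * card Y"
  unfolding cut_def
  by (subst card_image) (auto simp: inj_on_def doubleton_eq_iff card_cartesian_product)

lemma card_cut_edges_le:
  assumes "finite X" "finite Y" "\<And>v. v \<in> X \<Longrightarrow> card (nbrs E v Y) \<le> d"
  shows "card (E \<inter> cut X Y) \<le> d * card X"
proof -
  have fin: "finite (nbrs E v Y)" for v using assms(2) by (simp add: nbrs_def)
  have "E \<inter> cut X Y \<subseteq> (\<Union>v\<in>X. (\<lambda>w. {v, w}) ` nbrs E v Y)"
    by (auto simp: cut_def nbrs_def)
  then have "card (E \<inter> cut X Y) \<le> card (\<Union>v\<in>X. (\<lambda>w. {v, w}) ` nbrs E v Y)"
    using assms(1) fin by (intro card_mono) auto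
  also have "\<dots> \<le> (\<Sum>v\<in>X. card ((\<lambda>w. {v, w}) ` nbrs E v Y))"
    by (rule card_UN_le[OF assms(1)])
  also have "\<dots> \<le> (\<Sum>v\<in>X. d)"
    using fin assms(3) by (intro sum_mono) (meson card_image_le le_trans)
  finally show ?thesis by (simp add: mult.commute)
qed

text \<open>The union bound runs over the exact set of edges leaving \<open>X\<close>, at most
  \<open>d * card X\<close> of them, and \<open>s\<close> is the Chernoff parameter. At least 0.7 n
  vertices lie outside \<open>X\<close>.\<close>

lemma prob_sparse_cut_le:
  fixes p s :: real
  assumes p: "0 \<le> p" "p \<le> 1" and s: "1 \<le> s" and X: "X \<subseteq> {1..n}" "real (card X) \<le> 0.3 * real n"
  shows "measure_pmf.prob (random_graph n p) {E. \<forall>v\<in>X. card (nbrs E v ({1..n} - X)) < d} \<le>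
    s ^ (d * card X) * exp (- (p * (1 - 1 / s) * (0.7 * real n * real (card X))))"
    (is "measure_pmf.prob _ ?Q \<le> _")
proof -
  let ?Y = "{1..n} - X"
  let ?C = "cut X ?Y"
  have fin: "finite X" "finite ?Y" using X(1) finite_subset by auto
  then have finC: "finite ?C" by (simp add: cut_def)
  have sub: "?C \<subseteq> vertex_pairs n"
    unfolding vertex_pairs_eq using X(1) by (auto simp: cut_def pair_in_all_pairs)
  let ?I = "{B. B \<subseteq> ?C \<and> card B \<le> d * card X}"
  have "measure_pmf.prob (random_graph n p) ?Q \<le> (\<Sum>B\<in>?I. p ^ card B * (1 - p) ^ card (?C - B))"
  proof (rule prob_le_sum_if_covered[where A = "\<lambda>B. {E. B \<subseteq> E \<and> E \<inter> (?C - B) = {}}"])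
    show "finite ?I" using finC by simp
    show "?Q \<inter> set_pmf (random_graph n p) \<subseteq> (\<Union>B\<in>?I. {E. B \<subseteq> E \<and> E \<inter> (?C - B) = {}})"
    proof
      fix E assume "E \<in> ?Q \<inter> set_pmf (random_graph n p)"
      then have "card (E \<inter> ?C) \<le> d * card X"
        using fin by (intro card_cut_edges_le) (auto intro: less_imp_le)
      then have "E \<inter> ?C \<in> ?I" "E \<in> {E'. E \<inter> ?C \<subseteq> E' \<and> E' \<inter> (?C - E \<inter> ?C) = {}}" by auto
      then show "E \<in> (\<Union>B\<in>?I. {E. B \<subseteq> E \<and> E \<inter> (?C - B) = {}})" by blast
    qed
    show "measure_pmf.prob (random_graph n p) {E. B \<subseteq> E \<and> E \<inter> (?C - B) = {}} \<le>
        p ^ card B * (1 - p) ^ card (?C - B)" if "B \<in> ?I" for B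
      using that sub by (intro eq_refl[OF prob_random_graph_contains_avoids[OF p]]) auto
  qed
  also have "\<dots> \<le> s ^ (d * card X) * (p / s + (1 - p)) ^ card ?C"
    using finC p s by (intro sum_small_subsets_le) auto
  also have "\<dots> = s ^ (d * card X) * (1 - p * (1 - 1 / s)) ^ card ?C"
    by (simp add: algebra_simps)
  also have "\<dots> \<le> s ^ (d * card X) * exp (- (p * (1 - 1 / s) * (0.7 * real n * real (card X))))"
  proof (intro mult_left_mono power_one_minus_le_exp)
    show "0 \<le> p * (1 - 1 / s)" using p s by simp
    show "p * (1 - 1 / s) \<le> 1" using p s by (intro mult_le_one) auto
    have "card X \<le> n" using card_mono[OF _ X(1)] by simp
    then have "real (card ?Y) = real n - real (card X)"
      using X(1) fin by (simp add: card_Diff_subset of_nat_diff)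
    then have "0.7 * real n * real (card X) \<le> real (card X) * real (card ?Y)"
      using X(2) by (subst mult.commute) (intro mult_left_mono, auto)
    then show "0.7 * real n * real (card X) \<le> real (card ?C)"
      by (subst card_cut) auto
  qed (use s in auto)
  finally show ?thesis .
qed

subsection \<open>Probability estimates\<close>

text \<open>This covers n p < 251, where the dimension rounds down to 0. Distances are then empty
  sums.\<close>

lemma d_rigid_0:
  assumes "finite V" "E \<subseteq> all_pairs V"
  shows "d_rigid 0 V E"
proof -
  have "indep_family (rigidity_row 0 (\<lambda>_ _. 0)) ({} :: 'a set set)" by (simp add: indep_family_def)
  then obtain pos :: "'a \<Rightarrow> nat \<Rightarrow> real" where pos: "\<And>v i. 0 \<le> i \<Longrightarrow> pos v i = 0" "generic 0 V pos"
    using generic_placement_exists[OF assms(1), of "{}" 0] by (metis empty_subsetI)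
  have "framework 0 V E pos"
    using assms pos(1) by (auto simp: framework_def simple_graph_def topspace_Euclidean_space all_pairs_def)
  moreover have "rigid 0 V E pos" by (simp add: rigid_def edist_def)
  ultimately show ?thesis using pos(2) unfolding d_rigid_def by blast
qed

text \<open>Take \<open>s = exp 5\<close> and z = p n^2. In the exponent, choosing \<open>U\<close>
  costs at most n <= z / 251, the factor \<open>s ^ (d * n)\<close> costs 5 d n <= 5 z / 251, and
  the weights of the bases cost at most z / 64. Together this is below 0.0396 z, against a gain of
  0.04 z; the surplus exceeds 0.1 n because z >= 251 n.\<close>

lemma prob_sparse_flat_le_exp:
  fixes p :: real
  assumes p: "0 \<le> p" "p \<le> 1" and c: "251 \<le> real n * p" "251 * real d \<le> real n * p"
  shows "measure_pmf.prob (random_graph n p)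
      {E. \<exists>U\<subseteq>{1..n}. 0.04 * real n ^ 2 < real (card (all_pairs U - row_flat d x E U))} \<le>
    exp (- 0.1 * real n)"
proof -
  define z where "z = p * real n ^ 2"
  have z: "251 * real n \<le> z" "251 * (real d * real n) \<le> z"
    using mult_right_mono[OF c(1), of "real n"] mult_right_mono[OF c(2), of "real n"]
    by (simp_all add: z_def power2_eq_square mult_ac)
  have e1: "2 \<le> exp (1::real)" using exp_ge_add_one_self[of 1] by simp
  then have "2 ^ 5 \<le> exp (1::real) ^ 5" by (intro power_mono) auto
  then have e5: "32 \<le> exp (5::real)" by (simp flip: exp_of_nat_mult)
  have "(2::real) ^ n \<le> exp 1 ^ n" using e1 by (intro power_mono) auto
  then have two: "(2::real) ^ n \<le> exp (real n)" by (simp flip: exp_of_nat_mult)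
  have "z / (2 * exp 5) \<le> z / 64"
    using e5 z(1) by (intro divide_left_mono) auto
  then have half: "exp (p * real n ^ 2 / (2 * exp 5)) \<le> exp (z / 64)" by (simp add: z_def)
  have pow: "exp (5::real) ^ (d * n) = exp (5 * (real d * real n))"
    by (simp flip: exp_of_nat_mult add: mult_ac)
  have "measure_pmf.prob (random_graph n p)
      {E. \<exists>U\<subseteq>{1..n}. 0.04 * real n ^ 2 < real (card (all_pairs U - row_flat d x E U))} \<le>
    2 ^ n * (exp 5 ^ (d * n) * exp (p * real n ^ 2 / (2 * exp 5))) * exp (- (p * (0.04 * real n ^ 2)))"
    by (rule prob_sparse_flat_le[OF p]) simp
  also have "\<dots> \<le> exp (real n) * (exp (5 * (real d * real n)) * exp (z / 64)) * exp (- (0.04 * z))"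
    unfolding pow using two half
    by (intro mult_mono mult_nonneg_nonneg mult_left_mono) (auto simp: z_def)
  also have "\<dots> = exp (real n + 5 * (real d * real n) + z / 64 - 0.04 * z)"
    by (simp only: exp_add diff_conv_add_uminus mult.assoc)
  also have "\<dots> \<le> exp (- 0.1 * real n)"
    unfolding exp_le_cancel_iff power2_eq_square using z by linarith
  finally show ?thesis .
qed

text \<open>With \<open>s = exp 3\<close> and c = n p, the exponent for a set \<open>X\<close> is at
  most (3 / 251 - 0.7 * 7 / 8) c |X| <= -0.6 c |X|. A share of 0.06 becomes a common factor through
  |X| > \<open>\<eta>\<close> n. The other 0.54 exceeds the 1/2 in \<open>\<eta>\<close>, so summing
  over all \<open>X\<close> costs at most exp (\<open>\<eta>\<close> n).\<close>

lemma prob_sparse_cuts_le_exp: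
  fixes p :: real
  assumes p: "0 \<le> p" "p \<le> 1" and c: "251 \<le> real n * p" "251 * real d \<le> real n * p"
  defines "\<eta> \<equiv> exp (- (real n * p / 2))"
  shows "measure_pmf.prob (random_graph n p)
      {E. \<exists>X\<subseteq>{1..n}. \<eta> * real n < real (card X) \<and> real (card X) \<le> 0.3 * real n \<and>
        (\<forall>v\<in>X. card (nbrs E v ({1..n} - X)) < d)} \<le>
    exp (- 0.05 * (real n * p) * (\<eta> * real n))"
    (is "measure_pmf.prob _ ?Q \<le> _")
proof -
  define c where "c = real n * p"
  let ?I = "{X. X \<subseteq> {1..n} \<and> \<eta> * real n < real (card X) \<and> real (card X) \<le> 0.3 * real n}"
  have "2 \<le> exp (1::real)" using exp_ge_add_one_self[of 1] by simp
  then have "2 ^ 3 \<le> exp (1::real) ^ 3" by (intro power_mono) auto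
  then have e3: "8 \<le> exp (3::real)" by (simp flip: exp_of_nat_mult)
  have one: "measure_pmf.prob (random_graph n p) {E. \<forall>v\<in>X. card (nbrs E v ({1..n} - X)) < d} \<le>
      exp (- 0.06 * c * (\<eta> * real n)) * exp (- 0.54 * c) ^ card X" if X: "X \<in> ?I" for X
  proof -
    have cX: "0 \<le> c * real (card X)" using c by (simp add: c_def)
    have dX: "251 * (real d * real (card X)) \<le> c * real (card X)"
      using mult_right_mono[OF c(2), of "real (card X)"] by (simp add: c_def mult_ac)
    have "7 / 8 * (0.7 * (c * real (card X))) \<le> (1 - 1 / exp 3) * (0.7 * (c * real (card X)))"
      using e3 cX by (intro mult_right_mono) (auto simp: field_simps)
    also have "\<dots> = p * (1 - 1 / exp 3) * (0.7 * real n * real (card X))"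
      by (simp add: c_def)
    finally have low: "7 / 8 * (0.7 * (c * real (card X))) \<le> p * (1 - 1 / exp 3) * (0.7 * real n * real (card X))" .
    have eX: "c * (\<eta> * real n) \<le> c * real (card X)"
      using X c by (intro mult_left_mono) (auto simp: c_def)
    have "measure_pmf.prob (random_graph n p) {E. \<forall>v\<in>X. card (nbrs E v ({1..n} - X)) < d} \<le>
        exp 3 ^ (d * card X) * exp (- (p * (1 - 1 / exp 3) * (0.7 * real n * real (card X))))"
      using X by (intro prob_sparse_cut_le p) auto
    also have "\<dots> = exp (3 * (real d * real (card X)) - p * (1 - 1 / exp 3) * (0.7 * real n * real (card X)))"
    proof -
      have "exp (3::real) ^ (d * card X) = exp (3 * (real d * real (card X)))"
        by (simp flip: exp_of_nat_mult add: mult_ac)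
      then show ?thesis by (simp only: exp_add[symmetric] diff_conv_add_uminus)
    qed
    also have "\<dots> \<le> exp (- 0.06 * (c * (\<eta> * real n)) + - 0.54 * (c * real (card X)))"
    proof -
      have "3 * a - y \<le> - 0.06 * e + - 0.54 * b"
        if "7 / 8 * (0.7 * b) \<le> y" "251 * a \<le> b" "0 \<le> b" "e \<le> b" for a b e y :: real
        using that unfolding power2_eq_square by linarith
      from this[OF low dX cX eX] show ?thesis unfolding exp_le_cancel_iff .
    qed
    also have "\<dots> = exp (- 0.06 * c * (\<eta> * real n)) * exp (- 0.54 * c) ^ card X"
    proof -
      have "exp (- 0.54 * c) ^ card X = exp (- 0.54 * (c * real (card X)))"
        by (simp flip: exp_of_nat_mult add: mult_ac)
      then show ?thesis by (simp only: exp_add mult.assoc)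
    qed
    finally show ?thesis .
  qed
  have finI: "finite ?I" by simp
  have "measure_pmf.prob (random_graph n p) ?Q \<le>
      (\<Sum>X\<in>?I. exp (- 0.06 * c * (\<eta> * real n)) * exp (- 0.54 * c) ^ card X)"
    by (rule prob_le_sum_if_covered[OF finI _ one]) blast+
  also have "\<dots> \<le> (\<Sum>X\<in>Pow {1..n}. exp (- 0.06 * c * (\<eta> * real n)) * exp (- 0.54 * c) ^ card X)"
    by (intro sum_mono2) auto
  also have "\<dots> = exp (- 0.06 * c * (\<eta> * real n)) * (1 + exp (- 0.54 * c)) ^ n"
    using sum_Pow_weights[of "{1..n}" "exp (- 0.54 * c)" 1]
    by (simp add: sum_distrib_left[symmetric] add.commute)
  also have "\<dots> \<le> exp (- 0.06 * c * (\<eta> * real n)) * exp (\<eta> * real n)"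
  proof (rule mult_left_mono)
    have "exp (- 0.54 * c) \<le> \<eta>" using p by (simp add: \<eta>_def c_def)
    then have "(1 + exp (- 0.54 * c)) ^ n \<le> exp \<eta> ^ n"
      using exp_ge_add_one_self[of \<eta>] by (intro power_mono) (linarith, simp add: add_nonneg_nonneg)
    then show "(1 + exp (- 0.54 * c)) ^ n \<le> exp (\<eta> * real n)"
      by (simp add: mult.commute flip: exp_of_nat_mult)
  qed simp
  also have "\<dots> = exp (- 0.06 * (c * (\<eta> * real n)) + \<eta> * real n)"
    by (simp only: exp_add mult.assoc)
  also have "\<dots> \<le> exp (- 0.05 * (c * (\<eta> * real n)))"
  proof -
    \<comment> \<open>As \<open>c\<close> is at least 251, lowering 0.06 to 0.05 absorbs the cost of
      the sum over \<open>X\<close>.\<close>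
    have "251 * (\<eta> * real n) \<le> c * (\<eta> * real n)"
      using c by (intro mult_right_mono) (auto simp: c_def \<eta>_def)
    then have "100 * (\<eta> * real n) \<le> c * (\<eta> * real n)"
      by (smt (verit) \<eta>_def exp_ge_zero mult_nonneg_nonneg of_nat_0_le_iff)
    then show ?thesis unfolding exp_le_cancel_iff power2_eq_square by linarith
  qed
  finally show ?thesis by (simp add: c_def mult_ac)
qed

text \<open>For t = ln n - c / 2 >= 0, the bounds exp t >= 1 + t and c / 2 >= 1 give (c / 2) exp t
  >= c / 2 + t = ln n. With c = n p, the upper bound on \<open>p\<close> thus makes the failure
  probability of the cut estimate tend to 0.\<close>

lemma ln_le_mult_exp:
  fixes c n :: real
  assumes "2 \<le> c" "c \<le> 2 * ln n" "0 < n"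
  shows "2 * ln n \<le> c * (exp (- (c / 2)) * n)"
proof -
  have "0 \<le> (c / 2 - 1) * (ln n - c / 2)" using assms by (intro mult_nonneg_nonneg) auto
  then have "ln n \<le> c / 2 * (1 + (ln n - c / 2))" by (simp add: algebra_simps)
  also have "\<dots> \<le> c / 2 * exp (ln n - c / 2)"
    using assms exp_ge_add_one_self by (intro mult_left_mono) auto
  also have "exp (ln n - c / 2) = exp (- (c / 2)) * n"
    using assms by (simp add: exp_add mult.commute diff_conv_add_uminus del: add_uminus_conv_diff)
  finally show ?thesis by simp
qed

lemma prob_large_d_rigid_subgraph_ge:
  fixes p :: real
  assumes p: "0 \<le> p" "p \<le> 1" and c: "251 \<le> real n * p" "251 * real d \<le> real n * p" "real n * p \<le> 2 * ln (real n)"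
    and n: "1000 \<le> n" and d: "real d + 1 \<le> ln (real n)"
    and small: "real n ^ 2 * ln (real n) * exp (- ((0.12 * real n - 1) / ln (real n))) < 1"
  shows "1 - exp (- 0.1 * real n) - exp (- 0.1 * ln (real n)) \<le>
    measure_pmf.prob (random_graph n p)
      {E. \<exists>U. U \<subseteq> {1..n} \<and> real (card U) \<ge> (1 - exp (- (real n * p / 2))) * real n \<and>
        d_rigid d U (induced_edges E U)}"
    (is "_ \<le> measure_pmf.prob ?P ?S")
proof -
  obtain x where "\<And>B y. B \<subseteq> all_pairs {1..n} \<Longrightarrow> indep_family (rigidity_row d y) B \<Longrightarrow>
    indep_family (rigidity_row d x) B"
    using matroid_generic_placement_exists[of "{1..n}" d] by blast
  then interpret generic_placement "{1..n}" d x by unfold_locales auto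
  define \<eta> where "\<eta> = exp (- (real n * p / 2))"
  let ?Q1 = "{E. \<exists>U\<subseteq>{1..n}. 0.04 * real n ^ 2 < real (card (all_pairs U - row_flat d x E U))}"
  let ?Q2 = "{E. \<exists>X\<subseteq>{1..n}. \<eta> * real n < real (card X) \<and> real (card X) \<le> 0.3 * real n \<and>
        (\<forall>v\<in>X. card (nbrs E v ({1..n} - X)) < d)}"
  define s where "s = nat \<lfloor>0.12 * real n\<rfloor>"
  have s: "real s \<le> 0.12 * real n" "0.12 * real n - 1 \<le> real s"
  proof -
    have "real s = of_int \<lfloor>0.12 * real n\<rfloor>" by (simp add: s_def)
    then show "real s \<le> 0.12 * real n" "0.12 * real n - 1 \<le> real s" by linarith+
  qed
  have "\<eta> \<le> exp (- 125)" using c by (simp add: \<eta>_def)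
  also have "exp (- 125) \<le> 1 / (1 + 125 :: real)"
    using exp_ge_add_one_self[of 125] by (simp add: exp_minus field_simps)
  finally have \<eta>: "\<eta> \<le> 0.01" by simp
  have ln0: "0 < ln (real n)" using d by linarith
  have "ln (real n) \<le> 0.7 * real n"
    using ln_add_one_self_le_self2[of "real n / 2 - 1"] n ln_2_less_1
    by (simp add: ln_div)
  then have dn: "real d + 1 \<le> 0.7 * real n" using d by linarith
  \<comment> \<open>The bound (1 - 1/(d+1))^s <= exp (-s / (d + 1)) and d + 1 <= ln n reduce this to
    \<open>small\<close>, which mentions only \<open>n\<close>.\<close>
  have small': "real n ^ 2 * real (d + 1) * (real d / real (d + 1)) ^ s < 1"
  proof -
    have "(real d / real (d + 1)) ^ s = (1 - 1 / real (d + 1)) ^ s"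
      by (simp add: field_simps)
    also have "\<dots> \<le> exp (- (1 / real (d + 1) * (0.12 * real n - 1)))"
      using s by (intro power_one_minus_le_exp) auto
    also have "\<dots> \<le> exp (- ((0.12 * real n - 1) / ln (real n)))"
    proof -
      have "(0.12 * real n - 1) / ln (real n) \<le> (0.12 * real n - 1) / real (d + 1)"
        using d n ln0 by (intro divide_left_mono) auto
      then show ?thesis by simp
    qed
    finally have "(real d / real (d + 1)) ^ s \<le> exp (- ((0.12 * real n - 1) / ln (real n)))" .
    then have "real n ^ 2 * real (d + 1) * (real d / real (d + 1)) ^ s \<le>
        real n ^ 2 * ln (real n) * exp (- ((0.12 * real n - 1) / ln (real n)))"
      using d ln0 by (intro mult_mono) auto
    then show ?thesis using small by linarith
  qed
  have "set_pmf ?P \<subseteq> ?S \<union> (?Q1 \<union> ?Q2)"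
  proof
    fix E assume E: "E \<in> set_pmf ?P"
    show "E \<in> ?S \<union> (?Q1 \<union> ?Q2)"
    proof (rule ccontr)
      assume n': "E \<notin> ?S \<union> (?Q1 \<union> ?Q2)"
      have "E \<subseteq> all_pairs {1..n}" using set_pmf_random_graph[OF E] by (simp add: vertex_pairs_eq)
      then have "\<exists>U\<subseteq>{1..n}. (1 - \<eta>) * real (card {1..n}) \<le> real (card U) \<and> d_rigid d U (induced_edges E U)"
      proof (rule large_d_rigid_subgraph[where s = s])
        show "real (card (all_pairs U - row_flat d x E U)) \<le> 0.04 * real (card {1..n}) ^ 2"
          if "U \<subseteq> {1..n}" for U
          using n' that by (auto simp: not_less)
        show "\<exists>v\<in>X. d \<le> card (nbrs E v ({1..n} - X))"
          if "X \<subseteq> {1..n}" "\<eta> * real (card {1..n}) < real (card X)"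
            "real (card X) \<le> 0.3 * real (card {1..n})" for X
          using n' that by (auto simp: not_less)
      qed (use n \<eta> dn s small' in \<open>simp_all add: \<eta>_def\<close>)
      then have "E \<in> ?S" by (simp add: \<eta>_def)
      with n' show False by blast
    qed
  qed
  then have "1 \<le> measure_pmf.prob ?P (?S \<union> (?Q1 \<union> ?Q2))"
    using measure_pmf.finite_measure_mono[of "set_pmf ?P" "?S \<union> (?Q1 \<union> ?Q2)" ?P] measure_pmf_UNIV
    by (simp add: measure_pmf_UNIV measure_Int_set_pmf[of _ UNIV, simplified])
  also have "\<dots> \<le> measure_pmf.prob ?P ?S + measure_pmf.prob ?P (?Q1 \<union> ?Q2)"
    by (rule measure_Un_le) auto
  also have "measure_pmf.prob ?P (?Q1 \<union> ?Q2) \<le> measure_pmf.prob ?P ?Q1 + measure_pmf.prob ?P ?Q2"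
    by (rule measure_Un_le) auto
  also have "measure_pmf.prob ?P ?Q1 \<le> exp (- 0.1 * real n)"
    by (rule prob_sparse_flat_le_exp[OF p c(1,2)])
  also have "measure_pmf.prob ?P ?Q2 \<le> exp (- 0.05 * (real n * p) * (\<eta> * real n))"
    unfolding \<eta>_def by (rule prob_sparse_cuts_le_exp[OF p c(1,2)])
  also have "\<dots> \<le> exp (- 0.1 * ln (real n))"
    using ln_le_mult_exp[of "real n * p" "real n"] c n by (simp add: \<eta>_def mult_ac)
  finally show ?thesis by simp
qed

theorem theorem1p2:
  fixes p :: "nat \<Rightarrow> real"
  assumes "\<forall>\<^sub>F n in sequentially. 100 / real n \<le> p n \<and> p n \<le> 2 * ln (real n) / real n"
  shows "(\<lambda>n. measure_pmf.prob (random_graph n (p n))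
            {E. \<exists>U. U \<subseteq> {1..n} \<and>
                  real (card U) \<ge> (1 - exp (- (real n * p n / 2))) * real n \<and>
                  d_rigid (nat \<lfloor>real n * p n / 251\<rfloor>) U (induced_edges E U)})
         \<longlonglongrightarrow> 1"
    (is "(\<lambda>n. ?f n) \<longlonglongrightarrow> 1")
proof (rule tendsto_sandwich)
  show "(\<lambda>n. 1 - exp (- 0.1 * real n) - exp (- 0.1 * ln (real n))) \<longlonglongrightarrow> 1" by real_asymp
  show "\<forall>\<^sub>F n in sequentially. ?f n \<le> 1" by simp
  have "\<forall>\<^sub>F n in sequentially. 2 * ln (real n) \<le> real n" by real_asymp
  moreover have "\<forall>\<^sub>F n in sequentially.
      real n ^ 2 * ln (real n) * exp (- ((0.12 * real n - 1) / ln (real n))) < 1" by real_asymp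
  moreover have "\<forall>\<^sub>F n in sequentially. 2 \<le> ln (real n)" by real_asymp
  ultimately show "\<forall>\<^sub>F n in sequentially. 1 - exp (- 0.1 * real n) - exp (- 0.1 * ln (real n)) \<le> ?f n"
    using assms eventually_ge_at_top[of 1000]
  proof eventually_elim
    case (elim n)
    define d where "d = nat \<lfloor>real n * p n / 251\<rfloor>"
    have n0: "0 < real n" using elim by simp
    have np: "100 \<le> real n * p n" "real n * p n \<le> 2 * ln (real n)"
      using elim n0 by (auto simp: field_simps)
    have p0: "0 \<le> p n" using np(1) n0 by (smt (verit) mult_nonneg_nonpos)
    have p1: "p n \<le> 1" using elim np(2) n0 by (smt (verit) divide_le_eq_1)
    \<comment> \<open>In dimension 0 the whole vertex set works for every graph. Otherwise n p >=
      251, the lower bound on which the estimates rest.\<close>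
    show ?case
    proof (cases "d = 0")
      case True
      have "d_rigid 0 {1..n} (induced_edges E {1..n})" if "E \<in> set_pmf (random_graph n (p n))" for E
        using induced_edges_all_pairs set_pmf_random_graph[OF that]
        by (intro d_rigid_0) (auto simp: vertex_pairs_eq)
      then have "?f n = 1"
        using n0 True unfolding d_def[symmetric] measure_pmf.prob_eq_1[OF sets_measure_pmf[THEN equalityD2, THEN subsetD, OF UNIV_I]]
        by (intro AE_pmfI) (auto intro!: exI[of _ "{1..n}"] simp: mult_left_le_one_le)
      then show ?thesis
        using exp_gt_zero[of "- 0.1 * real n"] exp_gt_zero[of "- 0.1 * ln (real n)"] by linarith
    next
      case False
      have "real d \<le> real n * p n / 251"
        using np of_int_floor_le[of "real n * p n / 251"] by (simp add: d_def)
      moreover have "1 \<le> real d" using False by simp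
      ultimately have "251 * real d \<le> real n * p n" "251 \<le> real n * p n" by linarith+
      moreover have "real d + 1 \<le> ln (real n)" using calculation np(2) elim by linarith
      ultimately show ?thesis
        unfolding d_def[symmetric] using elim np p0 p1
        by (intro prob_large_d_rigid_subgraph_ge) auto
    qed
  qed
qed simp

end
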